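(* Let $M$ and $N$ be even nonnegative integers. Let $R=\{u_1<\cdots<u_M\}$ and $S=\{v_1<\cdots<v_N\}$ be totally ordered subsets of vertices in an acyclic digraph $D$. Let $A=(a_{u_iu_j})$ (resp. $B=(b_{v_iv_j})$) be a nonsingular skew-symmetric matrix with rows and columns indexed by the vertices of $R$ (resp. $S$), and let $z$ be an indeterminate. Then $$\sum_{\substack{0\le r\le\min(M,N)\\ r\text{ even}}}z^r\sum_{I\in\binom Rr}\sum_{J\in\binom Sr}\operatorname{Pf}(A^I_I)\operatorname{Pf}(B^J_J)\sum_{\pi\in S_r}\operatorname{sgn}(\pi)\,F^0(I^\pi,J)=\operatorname{Pf}(A)\operatorname{Pf}(B)\operatorname{Pf}\begin{pmatrix}\frac1{\operatorname{Pf}(A)}\widehat A&zH(R,S)J_N\\-zJ_N\,{}^tH(R,S)&\frac1{\operatorname{Pf}(B)}J_N\,{}^t\widehat B\,J_N\end{pmatrix}.$$ In particular, if $R$ is $D$-compatible with $S$, then $$\sum_{\substack{0\le r\le\min(M,N)\\ r\text{ even}}}z^r\sum_{I\in\binom Rr}\sum_{J\in\binom Sr}\operatorname{Pf}(A^I_I)\operatorname{Pf}(B^J_J)\,F^0(I,J)=\operatorname{Pf}(A)\operatorname{Pf}(B)\operatorname{Pf}\begin{pmatrix}\frac1{\operatorname{Pf}(A)}\widehat A&zH(R,S)J_N\\-zJ_N\,{}^tH(R,S)&\frac1{\operatorname{Pf}(B)}J_N\,{}^t\widehat B\,J_N\end{pmatrix}.$$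
   Context: $D=(V,E)$ is an acyclic digraph without multiple edges, with only finitely many directed paths between any two vertices. For vertices $u,v$, $\mathcal P(u,v)$ is the set of directed paths from $u$ to $v$. Each edge $e$ carries a commutative indeterminate $x_e$ as weight; the weight of a path is the product of the weights of its edges, and $h(u,v)=\sum_{P\in\mathcal P(u,v)}\operatorname{wt}(P)$. An $r$-vertex is an $r$-tuple of vertices. For $r$-vertices $\boldsymbol u,\boldsymbol v$, an $r$-path from $\boldsymbol u$ to $\boldsymbol v$ is $(P_1,\dots,P_r)$ with $P_i\in\mathcal P(u_i,v_i)$; its weight is the product of the weights of the $P_i$; it is non-intersecting if $P_i$ and $P_j$ share no vertex for all $i\ne j$. $F^0(\boldsymbol u,\boldsymbol v)$ is the sum of the weights of all non-intersecting $r$-paths from $\boldsymbol u$ to $\boldsymbol v$ (equal to $1$ for $r=0$). A finite totally ordered set of vertices is regarded as the tuple of its elements in increasing order; for a tuple $I=(w_1,\dots,w_r)$ and a permutation $\pi$, $I^\pi=(w_{\pi(1)},\dots,w_{\pi(r)})$. A tuple $(u_1,\dots,u_M)$ is $D$-compatible with $(v_1,\dots,v_N)$ if every path in $\mathcal P(u_i,v_l)$ intersects (shares a vertex with) every path in $\mathcal P(u_j,v_k)$ whenever $i<j$ and $k<l$. $H(R,S)=(h(u_i,v_j))_{1\le i\le M,1\le j\le N}$. $\binom Rr$ is the set of $r$-element subsets of $R$; $S_r$ is the symmetric group. $A^I_I$ is the submatrix of $A$ with rows and columns indexed by $I$. $\operatorname{Pf}$ is the Pfaffian of a skew-symmetric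 matrix of even size, normalized by $\operatorname{Pf}\begin{pmatrix}0&a\\-a&0\end{pmatrix}=a$ (empty Pfaffian $=1$). The copfaffian matrix $\widehat A$ of a skew-symmetric $A$ of even size is the skew-symmetric matrix with $(i,j)$ entry, for $i<j$, equal to $(-1)^{i+j-1}$ times the Pfaffian of $A$ with rows and columns $i,j$ removed. $J_N$ is the $N\times N$ matrix with ones on the antidiagonal and zeros elsewhere, ${}^tX$ the transpose. *)

theory Defs
  imports
    "HOL-Library.Poly_Mapping"
    "HOL-Combinatorics.Permutations"
    "Graph_Theory.Arc_Walk"
    "Jordan_Normal_Form.Determinant"
    "Jordan_Normal_Form.DL_Submatrix"
begin

section \<open>The polynomial ring in the edge indeterminates and \<open>z\<close>\<close>

datatype 'e indet = Edge 'e | Z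

text \<open>
  An element of \<open>('e, 'k) wpoly\<close> is a finitely supported map from monomials
  (finitely supported exponent vectors) to coefficients: this is the polynomial ring
  over \<open>'k\<close> in the commuting indeterminates \<open>x\<^sub>e\<close> (one for each \<open>e\<close>) and \<open>z\<close>.
\<close>

type_synonym ('e, 'k) wpoly = "('e indet \<Rightarrow>\<^sub>0 nat) \<Rightarrow>\<^sub>0 'k"

definition indet :: "'e indet \<Rightarrow> ('e, 'k::comm_ring_1) wpoly" where
  "indet t = Poly_Mapping.single (Poly_Mapping.single t 1) 1"

definition x_var :: "'e \<Rightarrow> ('e, 'k::comm_ring_1) wpoly" where
  "x_var e = indet (Edge e)"

definition z_var :: "('e, 'k::comm_ring_1) wpoly" where
  "z_var = indet Z"

definition const :: "'k::comm_ring_1 \<Rightarrow> ('e, 'k) wpoly" where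
  "const c = Poly_Mapping.single 0 c"

section \<open>Paths in a digraph\<close>

definition acyclic_digraph :: "('v, 'e) pre_digraph \<Rightarrow> bool" where
  "acyclic_digraph D \<longleftrightarrow> \<not> (\<exists>p. pre_digraph.cycle D p)"

text \<open>
  A path is given by its list of arcs, together with its start vertex; for \<open>u = v\<close> the
  trivial path \<open>[]\<close> is a path from \<open>u\<close> to \<open>v\<close>, of weight \<open>1\<close>.
\<close>

definition paths :: "('v, 'e) pre_digraph \<Rightarrow> 'v \<Rightarrow> 'v \<Rightarrow> 'e list set" where
  "paths D u v = {p. pre_digraph.apath D u p v}"

definition path_verts :: "('v, 'e) pre_digraph \<Rightarrow> 'v \<Rightarrow> 'e list \<Rightarrow> 'v set" where
  "path_verts D u p = set (pre_digraph.awalk_verts D u p)"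

definition path_weight :: "('e \<Rightarrow> 'a) \<Rightarrow> 'e list \<Rightarrow> 'a::comm_ring_1" where
  "path_weight w p = prod_list (map w p)"

definition path_gf :: "('v, 'e) pre_digraph \<Rightarrow> ('e \<Rightarrow> 'a) \<Rightarrow> 'v \<Rightarrow> 'v \<Rightarrow> 'a::comm_ring_1" where
  "path_gf D w u v = (\<Sum>p\<in>paths D u v. path_weight w p)"

text \<open>Tuples (of vertices, of paths) are lists, with positions counted from \<open>0\<close>.\<close>

definition nonintersecting_rpaths ::
  "('v, 'e) pre_digraph \<Rightarrow> 'v list \<Rightarrow> 'v list \<Rightarrow> 'e list list set" where
  "nonintersecting_rpaths D us vs =
     {ps. length ps = length us \<and>
          (\<forall>i<length us. ps ! i \<in> paths D (us ! i) (vs ! i)) \<and>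
          (\<forall>i<length us. \<forall>j<length us. i \<noteq> j \<longrightarrow>
             path_verts D (us ! i) (ps ! i) \<inter> path_verts D (us ! j) (ps ! j) = {})}"

text \<open>Only meaningful for tuples of equal length.\<close>

definition F0 ::
  "('v, 'e) pre_digraph \<Rightarrow> ('e \<Rightarrow> 'a) \<Rightarrow> 'v list \<Rightarrow> 'v list \<Rightarrow> 'a::comm_ring_1" where
  "F0 D w us vs =
     (\<Sum>ps\<in>nonintersecting_rpaths D us vs. \<Prod>i<length us. path_weight w (ps ! i))"

definition D_compatible :: "('v, 'e) pre_digraph \<Rightarrow> 'v list \<Rightarrow> 'v list \<Rightarrow> bool" where
  "D_compatible D us vs \<longleftrightarrow>
     (\<forall>i j k l. i < j \<and> j < length us \<and> k < l \<and> l < length vs \<longrightarrow>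
        (\<forall>p\<in>paths D (us ! i) (vs ! l). \<forall>q\<in>paths D (us ! j) (vs ! k).
           path_verts D (us ! i) p \<inter> path_verts D (us ! j) q \<noteq> {}))"

definition H_mat ::
  "('v, 'e) pre_digraph \<Rightarrow> ('e \<Rightarrow> 'a) \<Rightarrow> 'v list \<Rightarrow> 'v list \<Rightarrow> 'a::comm_ring_1 mat" where
  "H_mat D w us vs =
     mat (length us) (length vs) (\<lambda>(i, j). path_gf D w (us ! i) (vs ! j))"

section \<open>Subsets of a finite totally ordered set\<close>

text \<open>
  A finite totally ordered set is the distinct list \<open>us\<close> of its elements in increasing
  order. A subset \<open>I\<close> then has its own increasing tuple, and picks out a principal
  submatrix of a matrix whose rows and columns are indexed by the entries of \<open>us\<close>.
\<close>

definition subsets_of_size :: "nat \<Rightarrow> 'v list \<Rightarrow> 'v set set" where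
  "subsets_of_size r us = {I. I \<subseteq> set us \<and> card I = r}"

definition tuple_of :: "'v list \<Rightarrow> 'v set \<Rightarrow> 'v list" where
  "tuple_of us I = filter (\<lambda>v. v \<in> I) us"

definition permute_tuple :: "(nat \<Rightarrow> nat) \<Rightarrow> 'v list \<Rightarrow> 'v list" where
  "permute_tuple \<pi> ws = map (\<lambda>i. ws ! \<pi> i) [0..<length ws]"

definition positions :: "'v list \<Rightarrow> 'v set \<Rightarrow> nat set" where
  "positions us I = {i. i < length us \<and> us ! i \<in> I}"

definition principal_submatrix :: "'a mat \<Rightarrow> 'v list \<Rightarrow> 'v set \<Rightarrow> 'a mat" where
  "principal_submatrix A us I = submatrix A (positions us I) (positions us I)"

section \<open>Pfaffians\<close>

text \<open>
  The vanishing diagonal is implied by the other condition unless the characteristic is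
  \<open>2\<close>, where it is part of the usual meaning (``alternating'').
\<close>

definition skew_symmetric_mat :: "'a::comm_ring_1 mat \<Rightarrow> bool" where
  "skew_symmetric_mat A \<longleftrightarrow> square_mat A \<and>
     (\<forall>i<dim_row A. \<forall>j<dim_row A. A $$ (i, j) = - A $$ (j, i)) \<and>
     (\<forall>i<dim_row A. A $$ (i, i) = 0)"

text \<open>
  The perfect matchings of \<open>{0,\<dots>,n-1}\<close>, \<open>n\<close> even, in standard form: \<open>\<sigma>\<close> stands for the
  matching with blocks \<open>{\<sigma>(2i), \<sigma>(2i+1)}\<close>, each block written in increasing order and the
  blocks sorted by their smaller elements.
\<close>

definition matching_perms :: "nat \<Rightarrow> (nat \<Rightarrow> nat) set" where
  "matching_perms n =
     {\<sigma>. \<sigma> permutes {..<n} \<and>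
         (\<forall>i<n div 2. \<sigma> (2 * i) < \<sigma> (2 * i + 1)) \<and>
         (\<forall>i j. i < j \<and> j < n div 2 \<longrightarrow> \<sigma> (2 * i) < \<sigma> (2 * j))}"

definition Pf :: "'a::comm_ring_1 mat \<Rightarrow> 'a" where
  "Pf A = (\<Sum>\<sigma>\<in>matching_perms (dim_row A).
     of_int (sign \<sigma>) * (\<Prod>i<dim_row A div 2. A $$ (\<sigma> (2 * i), \<sigma> (2 * i + 1))))"

text \<open>
  With positions counted from \<open>0\<close>, the sign \<open>(-1)\<^sup>i\<^sup>+\<^sup>j\<^sup>-\<^sup>1\<close> of the \<open>1\<close>-based convention
  becomes \<open>(-1)\<^sup>i\<^sup>+\<^sup>j\<^sup>+\<^sup>1\<close>.
\<close>

definition copfaffian_mat :: "'a::comm_ring_1 mat \<Rightarrow> 'a mat" where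
  "copfaffian_mat A = mat (dim_row A) (dim_row A) (\<lambda>(i, j).
     let c = (-1) ^ (i + j + 1) * Pf (submatrix A (- {i, j}) (- {i, j}))
     in if i < j then c else if j < i then - c else 0)"

definition J_mat :: "nat \<Rightarrow> 'a::comm_ring_1 mat" where
  "J_mat n = mat n n (\<lambda>(i, j). if i + j + 1 = n then 1 else 0)"

definition block_mat ::
  "('v, 'e) pre_digraph \<Rightarrow> 'v list \<Rightarrow> 'v list \<Rightarrow> 'k::field mat \<Rightarrow> 'k mat \<Rightarrow> ('e, 'k) wpoly mat"
  where
  "block_mat D us vs A B =
     (let N = length vs; H = H_mat D x_var us vs
      in four_block_mat
           (map_mat const ((1 / Pf A) \<cdot>\<^sub>m copfaffian_mat A))
           (z_var \<cdot>\<^sub>m (H * J_mat N))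
           (- (z_var \<cdot>\<^sub>m (J_mat N * transpose_mat H)))
           (map_mat const ((1 / Pf B) \<cdot>\<^sub>m
              (J_mat N * transpose_mat (copfaffian_mat B) * J_mat N))))"

end

theory Submission
  imports Defs
begin

text \<open>
  The Pfaffian of an alternating form on a list of elements is defined by expansion along the
  first element; it is alternating under permutations of the list and invariant under adding to
  an element a combination of the others.

  Let \<open>G\<close> and \<open>W\<close> be alternating and \<open>C G = 1\<close>. Take elements \<open>P\<^sub>i\<close>, \<open>Q\<^sub>i\<close> with
  \<open>\<langle>P\<^sub>i, P\<^sub>j\<rangle> = G\<^sub>i\<^sub>j\<close>, \<open>\<langle>P\<^sub>i, Q\<^sub>j\<rangle> = \<delta>\<^sub>i\<^sub>j\<close>, \<open>\<langle>Q\<^sub>i, Q\<^sub>j\<rangle> = - W\<^sub>i\<^sub>j\<close>, and evaluate the Pfaffian of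
  \<open>P\<^sub>1, Q\<^sub>1, P\<^sub>2, Q\<^sub>2, \<dots>\<close> in two ways. Deciding for each \<open>i\<close> whether \<open>P\<^sub>i\<close> is matched with
  \<open>Q\<^sub>i\<close> gives \<open>\<Sum>\<^sub>K Pf(G\<^sub>K) Pf(W\<^sub>K)\<close>; replacing \<open>Q\<^sub>j\<close> by \<open>Q\<^sub>j + \<Sum>\<^sub>k C\<^sub>j\<^sub>k P\<^sub>k\<close>, which is
  orthogonal to all \<open>P\<^sub>i\<close>, gives \<open>Pf(G) Pf(W - C)\<close>. The theorem is the case
  \<open>G = diag(A, - B)\<close> with the second block in reversed order and \<open>W\<close> the off-diagonal block
  \<open>z H\<close>, whose principal minors are the determinants \<open>z\<^sup>r det H(I, J)\<close>. The
  Lindstroem-Gessel-Viennot involution turns these into signed sums of \<open>F\<^sup>0\<close>.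
\<close>

section \<open>Pfaffians of alternating forms on lists\<close>

definition del_nth :: "nat \<Rightarrow> 'a list \<Rightarrow> 'a list" where
  "del_nth j xs = take j xs @ drop (Suc j) xs"

lemma length_del_nth: "j < length xs \<Longrightarrow> length (del_nth j xs) = length xs - 1"
  by (simp add: del_nth_def)

lemma set_del_nth: "set (del_nth j xs) \<subseteq> set xs"
  using set_take_subset[of j xs] set_drop_subset[of "Suc j" xs] by (auto simp: del_nth_def)

lemma nth_del_nth:
  "k < length xs - 1 \<Longrightarrow> del_nth j xs ! k = (if k < j then xs ! k else xs ! Suc k)"
  by (cases "j < length xs") (auto simp: del_nth_def nth_append min_def)

lemma del_nth_append1: "j < length xs \<Longrightarrow> del_nth j (xs @ ys) = del_nth j xs @ ys"
  by (simp add: del_nth_def)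

lemma del_nth_append2: "length xs \<le> j \<Longrightarrow> del_nth j (xs @ ys) = xs @ del_nth (j - length xs) ys"
  by (simp add: del_nth_def Suc_diff_le)

lemma del_nth_map: "del_nth j (map f xs) = map f (del_nth j xs)"
  by (simp add: del_nth_def take_map drop_map)

lemma del_nth_rev:
  assumes "j < length xs"
  shows "del_nth (length xs - 1 - j) (rev xs) = rev (del_nth j xs)"
  using assms by (simp add: del_nth_def rev_take rev_drop Suc_diff_Suc)

lemma del_nth_del_nth:
  assumes "k < j" "j < length xs"
  shows "del_nth k (del_nth j xs) = del_nth (j - 1) (del_nth k xs)"
proof (rule nth_equalityI)
  show "length (del_nth k (del_nth j xs)) = length (del_nth (j - 1) (del_nth k xs))"
    using assms by (simp add: length_del_nth)
  fix i assume "i < length (del_nth k (del_nth j xs))"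
  then have i: "i < length xs - 2" using assms by (simp add: length_del_nth)
  then show "del_nth k (del_nth j xs) ! i = del_nth (j - 1) (del_nth k xs) ! i"
    using assms by (auto simp: nth_del_nth length_del_nth)
qed

text \<open>With a form evaluated on a list in place of a matrix, a principal submatrix is just a
  sublist, labels may have any type, and entries may be repeated or replaced. Lists of odd length
  get the value 0, see \<open>pfl_odd\<close>.\<close>

function pfl :: "('a \<Rightarrow> 'a \<Rightarrow> 'r) \<Rightarrow> 'a list \<Rightarrow> 'r::comm_ring_1" where
  "pfl w [] = 1"
| "pfl w (x # xs) = (\<Sum>j<length xs. (-1) ^ j * w x (xs ! j) * pfl w (del_nth j xs))"
  by pat_completeness auto
termination
  by (relation "measure (\<lambda>(w, xs). length xs)") (auto simp: length_del_nth)

text \<open>The vanishing diagonal is a separate clause because the coefficient ring may have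
  characteristic 2.\<close>

definition alternating_form :: "('a \<Rightarrow> 'a \<Rightarrow> 'r::comm_ring_1) \<Rightarrow> bool" where
  "alternating_form w \<longleftrightarrow> (\<forall>x. w x x = 0) \<and> (\<forall>x y. w x y = - w y x)"

lemma pfl_odd: "odd (length xs) \<Longrightarrow> pfl w xs = 0"
proof (induction "length xs" arbitrary: xs rule: less_induct)
  case less
  show ?case
  proof (cases xs)
    case (Cons x ys)
    have "pfl w (del_nth j ys) = 0" if "j < length ys" for j
      using less.prems that Cons
      by (intro less.hyps) (auto simp: length_del_nth less_Suc_eq)
    then show ?thesis using Cons by simp
  qed (use less.prems in simp)
qed

lemma pfl_cong:
  assumes "\<And>x y. x \<in> set xs \<Longrightarrow> y \<in> set xs \<Longrightarrow> w x y = w' x y"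
  shows "pfl w xs = pfl w' xs"
  using assms
proof (induction w xs rule: pfl.induct)
  case (2 w x xs)
  have "pfl w (del_nth j xs) = pfl w' (del_nth j xs)" if "j \<in> {..<length xs}" for j
    using set_del_nth[of j xs] 2(2) by (intro 2(1)[OF that]) auto
  then show ?case using 2(2) by (auto intro!: sum.cong)
qed simp

lemma pfl_map: "pfl w (map f xs) = pfl (\<lambda>x y. w (f x) (f y)) xs"
  by (induction "\<lambda>x y. w (f x) (f y)" xs rule: pfl.induct) (auto simp: del_nth_map intro!: sum.cong)

lemma pfl_smult: "even (length xs) \<Longrightarrow> pfl (\<lambda>x y. c * w x y) xs = c ^ (length xs div 2) * pfl w xs"
proof (induction "length xs" arbitrary: xs rule: less_induct)
  case less
  show ?case
  proof (cases xs)
    case (Cons x ys)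
    have *: "pfl (\<lambda>x y. c * w x y) (del_nth j ys) = c ^ ((length ys - 1) div 2) * pfl w (del_nth j ys)"
      if "j < length ys" for j
      using less.hyps[of "del_nth j ys"] less.prems that Cons by (auto simp: length_del_nth)
    obtain m where "length ys = Suc (2 * m)"
      using less.prems Cons by (auto elim!: oddE)
    then show ?thesis using Cons * by (auto simp: sum_distrib_left algebra_simps intro!: sum.cong)
  qed simp
qed

lemma pfl_uminus: "even (length xs) \<Longrightarrow> pfl (\<lambda>x y. - w x y) xs = (-1) ^ (length xs div 2) * pfl w xs"
  using pfl_smult[of xs "-1" w] by simp

text \<open>The first entry enters the expansion only through its values against the rest of the
  list. Entries are mere labels, so "\<open>z\<close> is \<open>x\<close> plus a combination of the
  \<open>v k\<close>" is expressed through these values.\<close>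

lemma pfl_Cons_linear:
  assumes "\<And>y. y \<in> set xs \<Longrightarrow> w z y = w x y + (\<Sum>k\<in>K. c k * w (v k) y)"
  shows "pfl w (z # xs) = pfl w (x # xs) + (\<Sum>k\<in>K. c k * pfl w (v k # xs))"
proof -
  have "pfl w (z # xs) = (\<Sum>j<length xs. (-1) ^ j * w x (xs ! j) * pfl w (del_nth j xs)
      + (\<Sum>k\<in>K. c k * ((-1) ^ j * w (v k) (xs ! j) * pfl w (del_nth j xs))))"
    using assms by (auto simp: algebra_simps sum_distrib_left sum_distrib_right intro!: sum.cong)
  also have "\<dots> = pfl w (x # xs) + (\<Sum>k\<in>K. c k * pfl w (v k # xs))"
    by (simp add: sum.distrib sum_distrib_left sum.swap[of _ K])
  finally show ?thesis .
qed

text \<open>Expands along the first two entries. They are either matched with each other or have two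
  distinct partners in \<open>zs\<close>, and the latter terms form a difference
  \<open>E x y - E y x\<close>. Only this shape of the remainder matters, hence the existential
  form: both antisymmetry and vanishing at \<open>x = y\<close> can be read off it.\<close>

lemma pfl_Cons_Cons:
  "\<exists>E :: 'a \<Rightarrow> 'a \<Rightarrow> 'r. \<forall>x y.
     pfl w (x # y # zs) = w x y * pfl w zs + E x y - E y x"
  for w :: "'a \<Rightarrow> 'a \<Rightarrow> 'r::comm_ring_1"
proof -
  define n where "n = length zs"
  \<comment> \<open>\<open>t x y (j, k)\<close> is the term in which \<open>x\<close> is matched
    with position \<open>j\<close> of \<open>zs\<close>, and \<open>y\<close> with position
    \<open>k\<close> of what is left after that deletion.\<close>
  define t where "t x y = (\<lambda>(j, k). (-1) ^ (j + k) * w x (zs ! j) * w y (del_nth j zs ! k)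
    * pfl w (del_nth k (del_nth j zs)))" for x y
  \<comment> \<open>Since \<open>k\<close> is counted after position \<open>j\<close> is deleted,
    \<open>j \<le> k\<close> means that the partner of \<open>y\<close> stands behind that of
    \<open>x\<close> in \<open>zs\<close>; \<open>L\<close> is the opposite case.\<close>
  define U where "U = {(j, k). j < n \<and> k < n - 1 \<and> j \<le> k}"
  define L where "L = {(j, k). j < n \<and> k < n - 1 \<and> k < j}"
  have fin: "finite U" "finite L"
    by (rule finite_subset[of _ "{..<n} \<times> {..<n-1}"]; auto simp: U_def L_def)+
  have "pfl w (x # y # zs) = w x y * pfl w zs + sum (t y x) U - sum (t x y) U" for x y
  proof -
    have inner: "pfl w (y # del_nth j zs) =
        (\<Sum>k<n - 1. (-1) ^ k * w y (del_nth j zs ! k) * pfl w (del_nth k (del_nth j zs)))"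
      if "j < n" for j
      using that by (simp add: n_def length_del_nth)
    have "pfl w (x # y # zs) = w x y * pfl w zs +
        (\<Sum>j<n. (-1) ^ Suc j * w x (zs ! j) * pfl w (y # del_nth j zs))"
      by (subst pfl.simps, simp only: length_Cons n_def[symmetric] sum.lessThan_Suc_shift)
         (simp add: del_nth_def)
    also have "(\<Sum>j<n. (-1) ^ Suc j * w x (zs ! j) * pfl w (y # del_nth j zs)) =
        - (\<Sum>j<n. \<Sum>k<n - 1. t x y (j, k))"
      unfolding sum_negf[symmetric]
      by (rule sum.cong) (auto simp: inner t_def sum_distrib_left sum_negf power_add algebra_simps
          simp del: pfl.simps)
    also have "(\<Sum>j<n. \<Sum>k<n - 1. t x y (j, k)) = sum (t x y) (U \<union> L)"
      unfolding sum.cartesian_product by (rule sum.cong) (auto simp: U_def L_def)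
    also have "\<dots> = sum (t x y) U + sum (t x y) L"
      using fin by (intro sum.union_disjoint) (auto simp: U_def L_def)
    \<comment> \<open>Exchanging the roles of \<open>x\<close> and \<open>y\<close> keeps both
      partners but turns \<open>(j, k)\<close> with \<open>k < j\<close> into
      \<open>(k, j - 1)\<close>. The exponent changes by one, which gives the minus sign.\<close>
    also have "sum (t x y) L = (\<Sum>p\<in>U. - t y x p)"
    proof (rule sum.reindex_bij_witness[where i = "\<lambda>(j, k). (Suc k, j)" and j = "\<lambda>(j, k). (k, j - 1)"])
      fix p assume "p \<in> L"
      then obtain j k where p: "p = (Suc j, k)" "Suc j < n" "k \<le> j"
        by (auto simp: L_def gr0_conv_Suc less_Suc_eq_le elim!: less_natE)
      then have "t y x (k, j) = - t x y (Suc j, k)"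
        by (simp add: t_def n_def nth_del_nth del_nth_del_nth[of k "Suc j"] power_add ac_simps)
      then show "- t y x (case p of (j, k) \<Rightarrow> (k, j - 1)) = t x y p"
        by (simp add: p)
    qed (auto simp: U_def L_def)
    finally show ?thesis by (simp add: sum_negf)
  qed
  then show ?thesis by (intro exI[of _ "\<lambda>x y. sum (t y x) U"]) blast
qed

section \<open>Alternation under permutations and invariance under shears\<close>

context
  fixes w :: "'a \<Rightarrow> 'a \<Rightarrow> 'r::comm_ring_1"
  assumes alt: "alternating_form w"
begin

lemma alt_self: "w x x = 0"
  using alt by (simp add: alternating_form_def)

lemma alt_swap: "w x y = - w y x"
  using alt unfolding alternating_form_def by blast

lemma pfl_swap_Cons: "pfl w (x # y # zs) = - pfl w (y # x # zs)"
proof -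
  from pfl_Cons_Cons[of w zs] obtain E where
    E: "\<forall>x y. pfl w (x # y # zs) = w x y * pfl w zs + E x y - E y x" ..
  show ?thesis by (simp only: E[rule_format] alt_swap[of x y]) (simp add: algebra_simps)
qed

text \<open>Antisymmetry alone would only show that twice the value is 0; the difference
  \<open>E x x - E x x\<close> cancels in every characteristic.\<close>

lemma pfl_self_Cons: "pfl w (x # x # zs) = 0"
proof -
  from pfl_Cons_Cons[of w zs] obtain E where
    E: "\<forall>x y. pfl w (x # y # zs) = w x y * pfl w zs + E x y - E y x" ..
  show ?thesis by (simp only: E[rule_format] alt_self mult_zero_left add_0 diff_self)
qed

text \<open>Expand along the first entry \<open>a\<close>. If the partner of \<open>a\<close> is
  neither \<open>x\<close> nor \<open>y\<close>, the swap survives in the shorter list and induction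
  applies; if it is one of them, the two remaining lists coincide and the sign comes from the
  shifted position.\<close>

lemma pfl_swap: "pfl w (xs @ x # y # zs) = - pfl w (xs @ y # x # zs)"
proof (induction "length xs + length zs" arbitrary: xs zs rule: less_induct)
  case less
  show ?case
  proof (cases xs)
    case Nil
    then show ?thesis by (simp only: append_Nil) (rule pfl_swap_Cons)
  next
    case (Cons a as)
    define p where "p = length as"
    define L where "L u v = as @ u # v # zs" for u v
    define T where "T u v j = (-1) ^ j * w a (L u v ! j) * pfl w (del_nth j (L u v))" for u v j
    let ?n = "p + 2 + length zs"
    \<comment> \<open>The partner of \<open>a\<close> is followed through the swap: the
      transposition of the positions \<open>p\<close> and \<open>Suc p\<close> sends each term to
      its counterpart in the swapped list.\<close>
    have T: "T x y (transpose p (Suc p) j) = - T y x j" if j: "j < ?n" for j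
    proof -
      consider "j < p" | "j = p" | "j = Suc p" | i where "j = p + 2 + i" "i < length zs"
        using j by (metis add_2_eq_Suc' less_Suc_eq nat_le_iff_add not_less nat_add_left_cancel_less)
      then show ?thesis
      proof cases
        case 1
        then have "pfl w (del_nth j as @ x # y # zs) = - pfl w (del_nth j as @ y # x # zs)"
          using Cons by (intro less.hyps) (auto simp: p_def length_del_nth)
        then show ?thesis using 1
          by (simp add: T_def L_def p_def del_nth_append1 nth_append transpose_apply_other)
      next
        case 2
        then show ?thesis by (simp add: T_def L_def p_def del_nth_def nth_append)
      next
        case 3
        then show ?thesis by (simp add: T_def L_def p_def del_nth_def nth_append)
      next
        case 4
        then have "pfl w (as @ x # y # del_nth i zs) = - pfl w (as @ y # x # del_nth i zs)"
          using Cons less.hyps[of as "del_nth i zs"] by (auto simp: p_def length_del_nth)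
        moreover have "del_nth j (L u v) = as @ u # v # del_nth i zs" for u v
          using 4 by (simp add: L_def del_nth_def p_def eval_nat_numeral)
        moreover have "L u v ! j = zs ! i" for u v
          using 4 by (simp add: L_def p_def nth_append)
        ultimately show ?thesis using 4
          by (simp add: T_def transpose_apply_other)
      qed
    qed
    have expand: "pfl w (xs @ u # v # zs) = (\<Sum>j<?n. T u v j)" for u v
      by (simp add: Cons T_def L_def p_def)
    have "(\<Sum>j<?n. T x y j) = (\<Sum>j<?n. T x y (transpose p (Suc p) j))"
      by (intro sum.permute[unfolded o_def] permutes_swap_id) auto
    also have "\<dots> = - (\<Sum>j<?n. T y x j)"
      by (simp add: T sum_negf)
    finally show ?thesis by (simp only: expand)
  qed
qed

lemma pfl_move: "pfl w (xs @ x # zs) = (-1) ^ length xs * pfl w (x # xs @ zs)"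
proof (induction xs arbitrary: zs rule: rev_induct)
  case (snoc a xs)
  have "pfl w (xs @ a # x # zs) = - pfl w (xs @ x # a # zs)" by (rule pfl_swap)
  also have "\<dots> = - ((-1) ^ length xs * pfl w (x # xs @ a # zs))" by (simp only: snoc)
  finally show ?case by (simp del: pfl.simps)
qed simp

lemma pfl_move_even:
  assumes "even (length ys)"
  shows "pfl w (xs @ x # ys @ zs) = pfl w (xs @ ys @ x # zs)"
  using pfl_move[of xs x "ys @ zs"] pfl_move[of "xs @ ys" x zs] assms
  by (simp add: power_add del: pfl.simps)

lemma pfl_repeated:
  assumes "x \<in> set xs"
  shows "pfl w (x # xs) = 0"
proof -
  obtain as bs where xs: "xs = as @ x # bs" using assms by (meson split_list)
  then show ?thesis
    using pfl_move[of "x # as" x bs] pfl_self_Cons[of x "as @ bs"] by (simp del: pfl.simps)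
qed

text \<open>After moving \<open>z\<close> to the front, linearity produces the term with
  \<open>x\<close> and terms headed by some \<open>v k\<close>; the latter contain
  \<open>v k\<close> twice and vanish.\<close>

lemma pfl_shear:
  assumes "\<And>y. y \<in> set (xs @ zs) \<Longrightarrow> w z y = w x y + (\<Sum>k\<in>K. c k * w (v k) y)"
    and "\<And>k. k \<in> K \<Longrightarrow> v k \<in> set (xs @ zs)"
  shows "pfl w (xs @ z # zs) = pfl w (xs @ x # zs)"
  using pfl_Cons_linear[of "xs @ zs" w z x c v K] assms
  by (simp add: pfl_move[of xs] pfl_repeated del: pfl.simps)

lemma pfl_rev_append: "pfl w (rev xs @ zs) = (-1) ^ (\<Sum>i<length xs. i) * pfl w (xs @ zs)"
proof (induction xs arbitrary: zs)
  case (Cons x xs)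
  have "pfl w (rev (x # xs) @ zs) = (-1) ^ (\<Sum>i<length xs. i) * pfl w (xs @ x # zs)"
    using Cons by simp
  then show ?case by (simp add: pfl_move[of xs] power_add del: pfl.simps)
qed simp

lemma pfl_rev: "pfl w (rev xs) = pfl (\<lambda>x y. - w x y) xs"
proof (cases "even (length xs)")
  case True
  then obtain m where m: "length xs = 2 * m" by (auto elim: evenE)
  \<comment> \<open>Reversing \<open>2 * m\<close> entries takes \<open>m * (2 * m - 1)\<close>
    adjacent swaps, a number of the same parity as \<open>m\<close>; negating the form produces one
    sign for each of the \<open>m\<close> blocks.\<close>
  have "even (\<Sum>i<2 * m. i) \<longleftrightarrow> even m" by (induction m) auto
  then have "(-1::'r) ^ (\<Sum>i<length xs. i) = (-1) ^ (length xs div 2)"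
    by (simp add: m minus_one_power_iff)
  then show ?thesis using pfl_rev_append[of xs "[]"] pfl_uminus[of xs w] True by simp
qed (simp add: pfl_odd)

end

lemma pfl_rev_uminus:
  assumes "alternating_form w"
  shows "pfl (\<lambda>x y. - w x y) (rev xs) = pfl w xs"
  using pfl_rev[OF assms, of "rev xs"] by simp

section \<open>Orthogonal and isotropic sublists\<close>

lemma pfl_orthogonal:
  assumes "\<And>x y. x \<in> set xs \<Longrightarrow> y \<in> set ys \<Longrightarrow> w x y = 0"
  shows "pfl w (xs @ ys) = pfl w xs * pfl w ys"
  using assms
proof (induction "length xs" arbitrary: xs rule: less_induct)
  case less
  show ?case
  proof (cases xs)
    case (Cons x as)
    have IH: "pfl w (del_nth j as @ ys) = pfl w (del_nth j as) * pfl w ys" if "j < length as" for j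
      using less.hyps[of "del_nth j as"] less.prems that Cons set_del_nth[of j as]
      by (force simp: length_del_nth)
    have "pfl w (xs @ ys) = (\<Sum>j<length as + length ys.
        (-1) ^ j * w x ((as @ ys) ! j) * pfl w (del_nth j (as @ ys)))"
      by (simp add: Cons)
    also have "\<dots> = (\<Sum>j<length as. (-1) ^ j * w x ((as @ ys) ! j) * pfl w (del_nth j (as @ ys)))"
      using less.prems Cons by (intro sum.mono_neutral_right) (auto simp: nth_append)
    also have "\<dots> = (\<Sum>j<length as. ((-1) ^ j * w x (as ! j) * pfl w (del_nth j as)) * pfl w ys)"
      by (rule sum.cong) (auto simp: nth_append del_nth_append1 IH mult.assoc)
    also have "\<dots> = pfl w xs * pfl w ys" by (simp add: Cons sum_distrib_right)
    finally show ?thesis .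
  qed simp
qed

text \<open>In a nonzero term every entry of \<open>ys\<close> would need a partner in
  \<open>xs\<close>, and there are too few of them. Each expansion step preserves the strict
  inequality of lengths.\<close>

lemma pfl_isotropic_right:
  assumes "\<And>x y. x \<in> set ys \<Longrightarrow> y \<in> set ys \<Longrightarrow> w x y = 0" and "length xs < length ys"
  shows "pfl w (xs @ ys) = 0"
  using assms
proof (induction "length xs" arbitrary: xs ys rule: less_induct)
  case less
  show ?case
  proof (cases xs)
    case Nil
    then show ?thesis using less.prems by (cases ys) auto
  next
    case (Cons x as)
    have "pfl w (del_nth j (as @ ys)) = 0" if j: "j < length as + length ys" for j
    proof (cases "j < length as")
      case True
      then have "pfl w (del_nth j as @ ys) = 0"
        using less.prems Cons by (intro less.hyps) (auto simp: length_del_nth)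
      then show ?thesis using True by (simp add: del_nth_append1)
    next
      case False
      then have "pfl w (as @ del_nth (j - length as) ys) = 0"
        using less.prems Cons j set_del_nth[of "j - length as" ys]
        by (intro less.hyps) (auto simp: length_del_nth)
      then show ?thesis using False by (simp add: del_nth_append2)
    qed
    then show ?thesis by (simp add: Cons)
  qed
qed

lemma pfl_isotropic_left:
  assumes "alternating_form w"
    and "\<And>x y. x \<in> set xs \<Longrightarrow> y \<in> set xs \<Longrightarrow> w x y = 0" and "length ys < length xs"
  shows "pfl w (xs @ ys) = 0"
  using pfl_rev_uminus[OF assms(1), of "xs @ ys"] assms(2,3)
    pfl_isotropic_right[of "rev xs" "\<lambda>x y. - w x y" "rev ys"] by simp

text \<open>Only matchings between \<open>xs\<close> and \<open>ys\<close> survive, and these are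
  permutations. With \<open>ys\<close> reversed, the matching of equal indices is nested and has
  sign 1, so no global sign appears. The expansion along the first entry becomes the Laplace
  expansion along row 0.\<close>

lemma pfl_isotropic_det:
  assumes "\<And>x y. x \<in> set ys \<Longrightarrow> y \<in> set ys \<Longrightarrow> w x y = 0" and "length xs = length ys"
  shows "pfl w (xs @ rev ys) = det (mat (length ys) (length ys) (\<lambda>(i, j). w (xs ! i) (ys ! j)))"
  using assms
proof (induction xs arbitrary: ys)
  case Nil
  then show ?case by simp
next
  case (Cons x as)
  define n where "n = length as"
  have n: "length ys = Suc n" using Cons.prems by (simp add: n_def)
  let ?A = "mat (Suc n) (Suc n) (\<lambda>(i, j). w ((x # as) ! i) (ys ! j))"
  let ?t = "\<lambda>j. (-1) ^ j * w x ((as @ rev ys) ! j) * pfl w (del_nth j (as @ rev ys))"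
  \<comment> \<open>Matching \<open>x\<close> inside \<open>as\<close> leaves fewer entries of
    \<open>as\<close> than of \<open>ys\<close>.\<close>
  have zero: "?t j = 0" if "j < n" for j
  proof -
    have "pfl w (del_nth j as @ rev ys) = 0"
      using Cons.prems that by (intro pfl_isotropic_right) (auto simp: length_del_nth n_def)
    then show ?thesis using that by (simp add: del_nth_append1 n_def)
  qed
  \<comment> \<open>In \<open>as @ rev ys\<close> the entry \<open>ys ! j\<close> stands at position
    \<open>n + (n - j)\<close>, whose parity is that of \<open>j\<close>.\<close>
  have eq: "?t (n + (n - j)) = w x (ys ! j) * cofactor ?A 0 j" if j: "j < Suc n" for j
  proof -
    have "pfl w (as @ rev (del_nth j ys)) =
        det (mat n n (\<lambda>(i, k). w (as ! i) (del_nth j ys ! k)))"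
      using Cons.IH[of "del_nth j ys"] Cons.prems set_del_nth[of j ys] j n
      by (auto simp: length_del_nth)
    also have "mat n n (\<lambda>(i, k). w (as ! i) (del_nth j ys ! k)) = mat_delete ?A 0 j"
      using j n by (intro eq_matI) (auto simp: mat_delete_def nth_del_nth)
    finally have "pfl w (del_nth (n + (n - j)) (as @ rev ys)) = det (mat_delete ?A 0 j)"
      using del_nth_rev[of j ys] j n
      by (simp add: del_nth_append2 n_def)
    moreover have "(-1::'b) ^ (n + (n - j)) = (-1) ^ j"
      using j by (simp add: minus_one_power_iff)
    moreover have "(as @ rev ys) ! (n + (n - j)) = ys ! j"
      using j n nth_append_length_plus[of as "rev ys" "n - j"] by (simp add: n_def rev_nth)
    ultimately show ?thesis by (simp add: cofactor_def)
  qed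
  have "pfl w ((x # as) @ rev ys) = (\<Sum>j<n + Suc n. ?t j)"
    using n by (simp add: n_def)
  also have "\<dots> = (\<Sum>j\<in>{n..<n + Suc n}. ?t j)"
    using zero by (intro sum.mono_neutral_right) (auto simp: not_le)
  also have "\<dots> = (\<Sum>j<Suc n. ?t (n + (n - j)))"
    by (rule sum.reindex_bij_witness[where i = "\<lambda>j. n + (n - j)" and j = "\<lambda>j. n + n - j"]) auto
  also have "\<dots> = (\<Sum>j<Suc n. ?A $$ (0, j) * cofactor ?A 0 j)"
    by (rule sum.cong) (use eq in auto)
  also have "\<dots> = det ?A"
    by (rule laplace_expansion_row[symmetric, of _ "Suc n"]) auto
  finally show ?case using n by simp
qed

section \<open>Agreement with the sum over perfect matchings\<close>

definition matching_sum :: "nat \<Rightarrow> (nat \<Rightarrow> nat \<Rightarrow> 'r::comm_ring_1) \<Rightarrow> 'r" where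
  "matching_sum n f = (\<Sum>\<sigma>\<in>matching_perms n.
     of_int (sign \<sigma>) * (\<Prod>i<n div 2. f (\<sigma> (2 * i)) (\<sigma> (2 * i + 1))))"

text \<open>Puts the block \<open>{0, Suc j}\<close> in front of \<open>\<tau>\<close>, whose values
  are moved monotonically to the remaining points. Building it from
  \<open>permutation_insert\<close> makes its sign available.\<close>

definition add_block :: "nat \<Rightarrow> (nat \<Rightarrow> nat) \<Rightarrow> nat \<Rightarrow> nat" where
  "add_block j \<tau> = permutation_insert 0 0 (permutation_insert 0 j \<tau>)"

lemma add_block_simps:
  "add_block j \<tau> 0 = 0" "add_block j \<tau> (Suc 0) = Suc j"
  "add_block j \<tau> (Suc (Suc k)) = Suc (if \<tau> k < j then \<tau> k else Suc (\<tau> k))"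
  by (simp_all add: add_block_def permutation_insert_expand)

lemma add_block_permutes:
  assumes "\<tau> permutes {..<n}" "j < Suc n"
  shows "add_block j \<tau> permutes {..<Suc (Suc n)}"
  using assms unfolding add_block_def lessThan_atLeast0
  by (intro permutation_insert_permutes) auto

lemma sign_add_block:
  assumes "\<tau> permutes {..<n}" "j < Suc n"
  shows "(of_int (sign (add_block j \<tau>)) :: 'r::comm_ring_1) = (-1) ^ j * of_int (sign \<tau>)"
  using assms unfolding add_block_def lessThan_atLeast0
  by (simp add: signof_permutation_insert[of _ "Suc n" 0 0] signof_permutation_insert[of _ n 0 j]
      permutation_insert_permutes)

lemma add_block_less_iff:
  "add_block j \<tau> (Suc (Suc k)) < add_block j \<tau> (Suc (Suc l)) \<longleftrightarrow> \<tau> k < \<tau> l"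
  by (auto simp: add_block_simps)

lemma add_block_in_matching_perms:
  assumes \<tau>: "\<tau> \<in> matching_perms n" and j: "j < Suc n"
  shows "add_block j \<tau> \<in> matching_perms (Suc (Suc n))"
proof -
  have "add_block j \<tau> (2 * i) < add_block j \<tau> (2 * i + 1)" if "i < Suc (n div 2)" for i
    using \<tau> that by (cases i) (auto simp: matching_perms_def add_block_simps)
  moreover have "add_block j \<tau> (2 * i) < add_block j \<tau> (2 * k)" if "i < k" "k < Suc (n div 2)" for i k
  proof (cases i)
    case 0
    then show ?thesis using that by (cases k) (auto simp: add_block_simps)
  next
    case (Suc i')
    then show ?thesis
      using that \<tau> add_block_less_iff[of j \<tau> "2 * i'" "2 * (k - 1)"]
      by (cases k) (auto simp: matching_perms_def)
  qed
  ultimately show ?thesis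
    using add_block_permutes[of \<tau> n j] \<tau> j by (simp add: matching_perms_def)
qed

text \<open>The value 0 at an odd place would contradict the order inside its block, and at a later
  even place the order of the blocks.\<close>

lemma matching_perms_0:
  assumes \<sigma>: "\<sigma> \<in> matching_perms n" and n: "even n" "n > 0"
  shows "\<sigma> 0 = 0"
proof -
  have perm: "\<sigma> permutes {..<n}" using \<sigma> by (simp add: matching_perms_def)
  then obtain k where k: "k < n" "\<sigma> k = 0"
    using n permutes_image[OF perm] by (metis imageE lessThan_iff)
  obtain m where "k = 2 * m \<or> k = 2 * m + 1"
    by (metis evenE oddE)
  then show ?thesis
  proof
    assume "k = 2 * m + 1"
    then have "m < n div 2" using k(1) n(1) by (auto elim!: evenE)
    then have "\<sigma> (2 * m) < \<sigma> k" using \<sigma> \<open>k = 2 * m + 1\<close> by (simp add: matching_perms_def)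
    then show ?thesis using k by simp
  next
    assume m: "k = 2 * m"
    show ?thesis
    proof (cases "m = 0")
      case False
      have "m < n div 2" using k(1) m n(1) by (auto elim!: evenE)
      moreover have "0 < m" using False by simp
      ultimately have "\<sigma> (2 * 0) < \<sigma> (2 * m)"
        using \<sigma> unfolding matching_perms_def by blast
      then show ?thesis using k m by simp
    qed (use k m in simp)
  qed
qed

text \<open>A perfect matching is determined by the partner of 0 and the matching of the remaining
  points; this bijection turns the sum over matchings into the expansion along the first
  entry.\<close>

lemma matching_perms_Suc_Suc:
  assumes "even n"
  shows "bij_betw (\<lambda>(j, \<tau>). add_block j \<tau>) ({..<Suc n} \<times> matching_perms n) (matching_perms (Suc (Suc n)))"
proof (rule bij_betw_imageI)
  show "inj_on (\<lambda>(j, \<tau>). add_block j \<tau>) ({..<Suc n} \<times> matching_perms n)"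
  proof (intro inj_onI, clarify)
    fix j \<tau> k \<rho>
    assume eq: "add_block j \<tau> = add_block k \<rho>"
    then have "j = k" using add_block_simps(2)[of j \<tau>] add_block_simps(2)[of k \<rho>] by simp
    moreover have "\<tau> i = \<rho> i" for i
      using fun_cong[OF eq, of "Suc (Suc i)"] \<open>j = k\<close> by (auto simp: add_block_simps split: if_splits)
    ultimately show "j = k \<and> \<tau> = \<rho>" by blast
  qed
  show "(\<lambda>(j, \<tau>). add_block j \<tau>) ` ({..<Suc n} \<times> matching_perms n) = matching_perms (Suc (Suc n))"
  proof (intro equalityI subsetI)
    fix \<sigma> assume \<sigma>: "\<sigma> \<in> matching_perms (Suc (Suc n))"
    have perm: "\<sigma> permutes {0..<Suc (Suc n)}"
      using \<sigma> by (simp add: matching_perms_def lessThan_atLeast0)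
    have 0: "\<sigma> 0 = 0" using matching_perms_0[OF \<sigma>] assms by simp
    \<comment> \<open>Deleting the place 0, which carries the value 0, and then the new first place
      recovers \<open>\<tau>\<close>. The value \<open>\<sigma>' 0\<close> is one less than the
      partner of 0, matching the shift in \<open>add_block\<close>.\<close>
    define \<sigma>' where "\<sigma>' = permutation_delete \<sigma> 0"
    have perm': "\<sigma>' permutes {0..<Suc n}"
      unfolding \<sigma>'_def using perm by (rule permutation_delete_permutes) simp
    have \<sigma>_eq: "\<sigma> = permutation_insert 0 0 \<sigma>'"
      using permutation_insert_delete[OF perm, of 0] 0 by (simp add: \<sigma>'_def)
    define \<tau> where "\<tau> = permutation_delete \<sigma>' 0"
    have perm'': "\<tau> permutes {0..<n}"
      unfolding \<tau>_def using perm' by (rule permutation_delete_permutes) simp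
    have "\<sigma>' = permutation_insert 0 (\<sigma>' 0) \<tau>"
      using permutation_insert_delete[OF perm', of 0] by (simp add: \<tau>_def)
    then have eq: "\<sigma> = add_block (\<sigma>' 0) \<tau>"
      using \<sigma>_eq by (simp add: add_block_def)
    have "\<sigma>' 0 < Suc n" using permutes_in_image[OF perm', of 0] by simp
    moreover have "\<tau> \<in> matching_perms n"
    proof -
      have "\<tau> (2 * i) < \<tau> (2 * i + 1)" if "i < n div 2" for i
      proof -
        have "\<sigma> (2 * Suc i) < \<sigma> (2 * Suc i + 1)"
          using \<sigma> that unfolding matching_perms_def by (auto simp del: mult_Suc_right)
        then show ?thesis by (simp add: eq add_block_less_iff)
      qed
      moreover have "\<tau> (2 * i) < \<tau> (2 * k)" if "i < k" "k < n div 2" for i k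
      proof -
        have "\<sigma> (2 * Suc i) < \<sigma> (2 * Suc k)"
          using \<sigma> that unfolding matching_perms_def by (auto simp del: mult_Suc_right)
        then show ?thesis by (simp add: eq add_block_less_iff)
      qed
      ultimately show ?thesis using perm'' by (simp add: matching_perms_def lessThan_atLeast0)
    qed
    ultimately show "\<sigma> \<in> (\<lambda>(j, \<tau>). add_block j \<tau>) ` ({..<Suc n} \<times> matching_perms n)"
      using eq by (auto intro!: image_eqI[of _ _ "(\<sigma>' 0, \<tau>)"])
  qed (auto simp: add_block_in_matching_perms)
qed

lemma matching_sum_Suc_Suc:
  assumes "even n"
  shows "matching_sum (Suc (Suc n)) f = (\<Sum>j<Suc n. (-1) ^ j * f 0 (Suc j) *
    matching_sum n (\<lambda>i k. f (Suc (if i < j then i else Suc i)) (Suc (if k < j then k else Suc k))))"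
proof -
  let ?s = "\<lambda>j i. Suc (if i < j then i else Suc i)"
  let ?t = "\<lambda>\<sigma>. of_int (sign \<sigma>) * (\<Prod>i<Suc (n div 2). f (\<sigma> (2 * i)) (\<sigma> (2 * i + 1)))"
  have "matching_sum (Suc (Suc n)) f = (\<Sum>(j, \<tau>)\<in>{..<Suc n} \<times> matching_perms n. ?t (add_block j \<tau>))"
    unfolding matching_sum_def
    using sum.reindex_bij_betw[OF matching_perms_Suc_Suc[OF assms], of ?t]
    by (simp add: case_prod_unfold)
  also have "\<dots> = (\<Sum>j<Suc n. \<Sum>\<tau>\<in>matching_perms n. ?t (add_block j \<tau>))"
    by (rule sum.cartesian_product[symmetric])
  also have "\<dots> = (\<Sum>j<Suc n. (-1) ^ j * f 0 (Suc j) * matching_sum n (\<lambda>i k. f (?s j i) (?s j k)))"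
  proof (rule sum.cong)
    fix j assume j: "j \<in> {..<Suc n}"
    have "?t (add_block j \<tau>) = (-1) ^ j * f 0 (Suc j) *
        (of_int (sign \<tau>) * (\<Prod>i<n div 2. f (?s j (\<tau> (2 * i))) (?s j (\<tau> (2 * i + 1)))))"
      if "\<tau> \<in> matching_perms n" for \<tau>
    proof -
      have "(of_int (sign (add_block j \<tau>)) :: 'a) = (-1) ^ j * of_int (sign \<tau>)"
        using that j by (intro sign_add_block[of \<tau> n]) (auto simp: matching_perms_def)
      moreover have "(\<Prod>i<Suc (n div 2). f (add_block j \<tau> (2 * i)) (add_block j \<tau> (2 * i + 1))) =
          f 0 (Suc j) * (\<Prod>i<n div 2. f (?s j (\<tau> (2 * i))) (?s j (\<tau> (2 * i + 1))))"
        by (simp only: prod.lessThan_Suc_shift) (simp add: add_block_simps cong: if_cong)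
      ultimately show ?thesis by (simp only: mult_ac)
    qed
    then show "(\<Sum>\<tau>\<in>matching_perms n. ?t (add_block j \<tau>)) =
        (-1) ^ j * f 0 (Suc j) * matching_sum n (\<lambda>i k. f (?s j i) (?s j k))"
      by (simp add: matching_sum_def sum_distrib_left)
  qed simp
  finally show ?thesis .
qed

lemma matching_perms_less:
  "\<sigma> \<in> matching_perms n \<Longrightarrow> i < n \<Longrightarrow> \<sigma> i < n"
  using permutes_in_image[of \<sigma> "{..<n}" i] by (simp add: matching_perms_def)

lemma matching_sum_cong:
  assumes "\<And>i k. i < n \<Longrightarrow> k < n \<Longrightarrow> f i k = g i k"
  shows "matching_sum n f = matching_sum n g"
  unfolding matching_sum_def
proof (intro sum.cong arg_cong2[of _ _ _ _ "(*)"] prod.cong refl)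
  fix \<sigma> i assume \<sigma>: "\<sigma> \<in> matching_perms n" and "i \<in> {..<n div 2}"
  then have "2 * i < n" "2 * i + 1 < n" by auto
  then show "f (\<sigma> (2 * i)) (\<sigma> (2 * i + 1)) = g (\<sigma> (2 * i)) (\<sigma> (2 * i + 1))"
    using assms matching_perms_less[OF \<sigma>] by blast
qed

text \<open>By \<open>matching_sum_Suc_Suc\<close> both sides satisfy the same recursion in the
  length of the list.\<close>

lemma matching_sum_pfl:
  assumes "even (length xs)"
  shows "matching_sum (length xs) (\<lambda>i k. w (xs ! i) (xs ! k)) = pfl w xs"
  using assms
proof (induction "length xs" arbitrary: xs rule: less_induct)
  case less
  show ?case
  proof (cases xs)
    case Nil
    then show ?thesis by (auto simp: matching_sum_def matching_perms_def)
  next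
    case (Cons x ys)
    then obtain n where n: "length ys = Suc n" "even n"
      using less.prems by (cases "length ys") auto
    have "matching_sum (length xs) (\<lambda>i k. w (xs ! i) (xs ! k)) =
      (\<Sum>j<Suc n. (-1) ^ j * w x (ys ! j) * matching_sum n (\<lambda>i k. w (del_nth j ys ! i) (del_nth j ys ! k)))"
      unfolding Cons length_Cons n(1) matching_sum_Suc_Suc[OF n(2)]
      by (intro sum.cong refl arg_cong2[of _ _ _ _ "(*)"] matching_sum_cong) (auto simp: nth_del_nth n)
    also have "\<dots> = (\<Sum>j<Suc n. (-1) ^ j * w x (ys ! j) * pfl w (del_nth j ys))"
    proof (rule sum.cong)
      fix j assume j: "j \<in> {..<Suc n}"
      then have "length (del_nth j ys) = n" using n by (simp add: length_del_nth)
      then show "(-1) ^ j * w x (ys ! j) * matching_sum n (\<lambda>i k. w (del_nth j ys ! i) (del_nth j ys ! k))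
          = (-1) ^ j * w x (ys ! j) * pfl w (del_nth j ys)"
        using less.hyps[of "del_nth j ys"] n Cons by (simp only: length_Cons less_Suc_eq) simp
    qed simp
    also have "\<dots> = pfl w xs" by (simp only: Cons pfl.simps n)
    finally show ?thesis .
  qed
qed

lemma Pf_eq_pfl:
  assumes "even (dim_row A)"
  shows "Pf A = pfl (\<lambda>i j. A $$ (i, j)) [0..<dim_row A]"
proof -
  have "pfl (\<lambda>i j. A $$ (i, j)) [0..<dim_row A] =
      matching_sum (dim_row A) (\<lambda>i j. A $$ ([0..<dim_row A] ! i, [0..<dim_row A] ! j))"
    using matching_sum_pfl[of "[0..<dim_row A]" "\<lambda>i j. A $$ (i, j)"] assms by simp
  also have "\<dots> = matching_sum (dim_row A) (\<lambda>i j. A $$ (i, j))"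
    by (rule matching_sum_cong) simp
  finally show ?thesis by (simp add: Pf_def matching_sum_def)
qed

section \<open>Principal submatrices as sublists\<close>

lemma map_pick: "map (pick P) [0..<card {i. i < n \<and> i \<in> P}] = filter (\<lambda>i. i \<in> P) [0..<n]"
proof (induction n)
  case (Suc n)
  show ?case
  proof (cases "n \<in> P")
    case True
    then have "{i. i < Suc n \<and> i \<in> P} = insert n {i. i < n \<and> i \<in> P}" by auto
    moreover have "{i. i < n \<and> i \<in> P} = {a \<in> P. a < n}" by auto
    ultimately show ?thesis using Suc True pick_card_in_set[OF True] by simp
  next
    case False
    then have "{i. i < Suc n \<and> i \<in> P} = {i. i < n \<and> i \<in> P}" by (auto simp: less_Suc_eq)
    then show ?thesis using Suc False by simp
  qed
qed simp

lemma Pf_submatrix: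
  assumes "A \<in> carrier_mat n n" and "even (card {i. i < n \<and> i \<in> P})"
  shows "Pf (submatrix A P P) = pfl (\<lambda>i j. A $$ (i, j)) (filter (\<lambda>i. i \<in> P) [0..<n])"
proof -
  let ?m = "card {i. i < n \<and> i \<in> P}"
  have dim: "dim_row (submatrix A P P) = ?m" "dim_col (submatrix A P P) = ?m"
    using assms(1) by (auto simp: dim_submatrix)
  have "Pf (submatrix A P P) = pfl (\<lambda>i j. submatrix A P P $$ (i, j)) [0..<?m]"
    using assms(2) by (simp add: Pf_eq_pfl dim)
  also have "\<dots> = pfl (\<lambda>i j. A $$ (pick P i, pick P j)) [0..<?m]"
    using assms(1) by (intro pfl_cong) (auto simp: submatrix_index)
  also have "\<dots> = pfl (\<lambda>i j. A $$ (i, j)) (map (pick P) [0..<?m])"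
    by (rule pfl_map[symmetric])
  finally show ?thesis by (simp add: map_pick)
qed

section \<open>A Pfaffian sum over subsets\<close>

lemma alternating_uminus:
  assumes "alternating_form w"
  shows "alternating_form (\<lambda>i j. - w i j)"
proof -
  have "- w x y = - (- w y x)" for x y
    using alt_swap[OF assms, of x y] by (rule arg_cong)
  then show ?thesis
    unfolding alternating_form_def using alt_self[OF assms] by (metis minus_zero)
qed

lemma alternating_diff:
  assumes "alternating_form w" "alternating_form w'"
  shows "alternating_form (\<lambda>i j. w i j - w' i j)"
proof -
  have "w x y - w' x y = - (w y x - w' y x)" for x y
  proof -
    have "w x y - w' x y = - w y x - - w' y x"
      using alt_swap[OF assms(1), of x y] alt_swap[OF assms(2), of x y] by (rule arg_cong2)
    then show ?thesis by simp
  qed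
  moreover have "w x x - w' x x = 0" for x
    by (simp only: alt_self[OF assms(1)] alt_self[OF assms(2)] diff_self)
  ultimately show ?thesis unfolding alternating_form_def by blast
qed

text \<open>
  \<open>Orig i\<close> and \<open>Dual i\<close> are the elements \<open>P\<^sub>i\<close> and \<open>Q\<^sub>i\<close>, with \<open>E\<close> for the pairing between them.
  \<open>Cut i\<close> is \<open>P\<^sub>i\<close> made orthogonal to all \<open>Q\<^sub>j\<close>, and \<open>Elim i\<close> is \<open>Q\<^sub>i\<close> made orthogonal to all
  \<open>P\<^sub>j\<close>; the values on pairs \<open>(Cut i, Elim j)\<close> never matter.
\<close>

datatype 'i node = Orig 'i | Cut 'i | Dual 'i | Elim 'i

text \<open>\<open>V\<close> is the form on the \<open>Dual\<close> entries. A \<open>Dual\<close>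
  differs from its \<open>Elim\<close> by a combination of \<open>Orig\<close> entries, to which
  every \<open>Elim\<close> is orthogonal; so one form \<open>F\<close> gives the values for
  \<open>Elim\<close> with \<open>Dual\<close> as well as with \<open>Elim\<close>.\<close>

fun node_form ::
  "('i \<Rightarrow> 'i \<Rightarrow> 'r) \<Rightarrow> ('i \<Rightarrow> 'i \<Rightarrow> 'r) \<Rightarrow> ('i \<Rightarrow> 'i \<Rightarrow> 'r) \<Rightarrow> ('i \<Rightarrow> 'i \<Rightarrow> 'r) \<Rightarrow>
     'i node \<Rightarrow> 'i node \<Rightarrow> 'r::comm_ring_1" where
  "node_form G E V F (Orig i) (Orig j) = G i j"
| "node_form G E V F (Orig i) (Cut j) = G i j"
| "node_form G E V F (Cut i) (Orig j) = G i j"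
| "node_form G E V F (Cut i) (Cut j) = G i j"
| "node_form G E V F (Orig i) (Dual j) = E i j"
| "node_form G E V F (Dual i) (Orig j) = - E j i"
| "node_form G E V F (Dual i) (Dual j) = V i j"
| "node_form G E V F (Dual i) (Elim j) = F i j"
| "node_form G E V F (Elim i) (Dual j) = F i j"
| "node_form G E V F (Elim i) (Elim j) = F i j"
| "node_form G E V F (Cut i) (Dual j) = 0"
| "node_form G E V F (Dual i) (Cut j) = 0"
| "node_form G E V F (Orig i) (Elim j) = 0"
| "node_form G E V F (Elim i) (Orig j) = 0"
| "node_form G E V F (Cut i) (Elim j) = 0"
| "node_form G E V F (Elim i) (Cut j) = 0"

lemma alternating_node_form:
  assumes "alternating_form G" "alternating_form V" "alternating_form F"
  shows "alternating_form (node_form G E V F)"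
  unfolding alternating_form_def
proof (intro conjI allI)
  show "node_form G E V F x x = 0" for x
    using assms by (cases x) (simp_all add: alt_self)
  show "node_form G E V F x y = - node_form G E V F y x" for x y
    by (cases x; cases y) (simp_all, (rule alt_swap, rule assms)+)
qed

definition dual_pairs :: "('i \<Rightarrow> 'i node) \<Rightarrow> 'i list \<Rightarrow> 'i node list" where
  "dual_pairs f js = concat (map (\<lambda>i. [f i, Dual i]) js)"

lemma dual_pairs_simps [simp]:
  "dual_pairs f [] = []" "dual_pairs f (i # js) = f i # Dual i # dual_pairs f js"
  by (simp_all add: dual_pairs_def)

lemma even_length_dual_pairs [simp]: "even (length (dual_pairs f js))"
  by (induction js) auto

lemma set_dual_pairs [simp]: "set (dual_pairs f js) = f ` set js \<union> Dual ` set js"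
  by (induction js) auto

text \<open>Each \<open>Dual i\<close> moves past the pairs behind it, an even number of entries, so
  passing from the interleaved to the nested order costs no sign.\<close>

lemma pfl_dual_pairs:
  assumes "alternating_form w"
  shows "pfl w (xs @ dual_pairs f js @ zs) = pfl w (xs @ map f js @ map Dual (rev js) @ zs)"
proof (induction js arbitrary: xs zs)
  case (Cons i js)
  have "pfl w (xs @ dual_pairs f (i # js) @ zs) = pfl w ((xs @ [f i]) @ dual_pairs f js @ Dual i # zs)"
    using pfl_move_even[OF assms, of "dual_pairs f js" "xs @ [f i]" "Dual i" zs] by simp
  then show ?case unfolding Cons by simp
qed simp

text \<open>Formally \<open>x\<close> is \<open>x'\<close> plus an element that pairs to 1 with
  \<open>v\<close> and to 0 with \<open>zs\<close>. That element contributes only through the first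
  term of the expansion, whose sign is positive.\<close>

lemma pfl_split_pair:
  assumes "\<And>y. y \<in> set zs \<Longrightarrow> w x y = w x' y" and "w x v = w x' v + 1"
  shows "pfl w (x # v # zs) = pfl w zs + pfl w (x' # v # zs)"
  using assms by (simp only: pfl.simps length_Cons sum.lessThan_Suc_shift)
    (simp add: del_nth_def algebra_simps)

text \<open>For each index, \<open>pfl_split_pair\<close> either matches \<open>Orig i\<close> with
  \<open>Dual i\<close> and drops both, or replaces \<open>Orig i\<close> by \<open>Cut i\<close>.
  The set \<open>K\<close> collects the indices of the second kind.\<close>

lemma pfl_dual_pairs_expand:
  assumes w: "w = node_form G (\<lambda>i j. if i = j then 1 else 0) V F" and alt: "alternating_form w"
    and "distinct js" and "\<And>i. i \<in> set js \<Longrightarrow> Dual i \<notin> set zs"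
  shows "pfl w (dual_pairs Orig js @ zs) =
    (\<Sum>K\<in>Pow (set js). pfl w (dual_pairs Cut (filter (\<lambda>i. i \<in> K) js) @ zs))"
  using assms(3,4)
proof (induction js arbitrary: zs)
  case (Cons i js)
  let ?d = "\<lambda>K js. dual_pairs Cut (filter (\<lambda>i. i \<in> K) js)"
  \<comment> \<open>A pair that has been treated is moved behind the untreated ones, where it joins
    \<open>zs\<close> and the induction hypothesis applies.\<close>
  have move: "pfl w (Cut i # Dual i # dual_pairs f ks @ zs) = pfl w (dual_pairs f ks @ Cut i # Dual i # zs)"
    for f ks
    using pfl_move_even[OF alt, of "dual_pairs f ks" "[Cut i]" "Dual i" zs]
      pfl_move_even[OF alt, of "dual_pairs f ks" "[]" "Cut i" "Dual i # zs"]
    by (simp del: pfl.simps)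
  have "pfl w (dual_pairs Orig (i # js) @ zs) =
      pfl w (dual_pairs Orig js @ zs) + pfl w (Cut i # Dual i # dual_pairs Orig js @ zs)"
  proof (simp only: dual_pairs_simps append_Cons, rule pfl_split_pair)
    fix y assume "y \<in> set (dual_pairs Orig js @ zs)"
    then have "y \<noteq> Dual i" using Cons.prems by auto
    then show "w (Orig i) y = w (Cut i) y" by (cases y) (auto simp: w)
  qed (simp add: w)
  also have "pfl w (dual_pairs Orig js @ zs) = (\<Sum>K\<in>Pow (set js). pfl w (?d K (i # js) @ zs))"
    using Cons by (auto intro!: sum.cong simp del: pfl.simps)
  also have "pfl w (Cut i # Dual i # dual_pairs Orig js @ zs) =
      (\<Sum>K\<in>Pow (set js). pfl w (Cut i # Dual i # ?d K js @ zs))"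
    unfolding move using Cons.prems by (intro Cons.IH) auto
  also have "\<dots> = (\<Sum>K\<in>Pow (set js). pfl w (?d (insert i K) (i # js) @ zs))"
  proof (rule sum.cong)
    fix K
    have "filter (\<lambda>k. k \<in> insert i K) js = filter (\<lambda>k. k \<in> K) js"
      using Cons.prems by (intro filter_cong) auto
    then show "pfl w (Cut i # Dual i # ?d K js @ zs) = pfl w (?d (insert i K) (i # js) @ zs)"
      by (simp del: pfl.simps)
  qed simp
  also have "\<dots> = (\<Sum>K\<in>insert i ` Pow (set js). pfl w (?d K (i # js) @ zs))"
  proof -
    have "inj_on (insert i) (Pow (set js))"
      using Cons.prems by (intro inj_onI) (metis Pow_iff distinct.simps(2) insert_ident subsetD)
    then show ?thesis by (simp add: sum.reindex)
  qed
  also have "(\<Sum>K\<in>Pow (set js). pfl w (?d K (i # js) @ zs)) + \<dots> =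
      (\<Sum>K\<in>Pow (set (i # js)). pfl w (?d K (i # js) @ zs))"
    unfolding list.set Pow_insert using Cons.prems by (intro sum.union_disjoint[symmetric]) auto
  finally show ?case .
qed simp

text \<open>\<open>Elim j\<close> stands for \<open>Dual j\<close> plus the combination of the
  \<open>Orig k\<close> with coefficients \<open>c j k\<close>. The first condition on
  \<open>c\<close> makes it orthogonal to every \<open>Orig i\<close>, the second computes its value
  against \<open>Dual i\<close>. After all replacements the two halves are orthogonal and the
  Pfaffian factors.\<close>

lemma pfl_elim:
  assumes alt: "alternating_form G" "alternating_form V" "alternating_form F"
    and G: "\<And>i j. i \<in> set js \<Longrightarrow> j \<in> set js \<Longrightarrow> (\<Sum>k\<in>set js. c j k * G k i) = E i j"
    and E: "\<And>i j. i \<in> set js \<Longrightarrow> j \<in> set js \<Longrightarrow> F j i = V j i + (\<Sum>k\<in>set js. c j k * E k i)"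
  shows "pfl (node_form G E V F) (map Orig js @ map Dual (rev js)) = pfl G js * pfl F (rev js)"
proof -
  let ?w = "node_form G E V F"
  \<comment> \<open>The \<open>Dual\<close> entries are replaced one by one from the right;
    \<open>ls\<close> lists those already replaced.\<close>
  have "pfl ?w (map Orig js @ map Dual ks @ map Elim ls) = pfl ?w (map Orig js @ map Elim (ks @ ls))"
    if "set ks \<subseteq> set js" "set ls \<subseteq> set js" for ks ls
    using that
  proof (induction ks arbitrary: ls rule: rev_induct)
    case (snoc j ks)
    have "pfl ?w ((map Orig js @ map Dual ks) @ Elim j # map Elim ls) =
        pfl ?w ((map Orig js @ map Dual ks) @ Dual j # map Elim ls)"
    proof (rule pfl_shear[OF alternating_node_form[OF alt], where K = "set js" and c = "c j" and v = Orig])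
      fix y assume "y \<in> set ((map Orig js @ map Dual ks) @ map Elim ls)"
      then obtain i where "i \<in> set js" "y = Orig i \<or> y = Dual i \<or> y = Elim i"
        using snoc.prems by auto
      then show "?w (Elim j) y = ?w (Dual j) y + (\<Sum>k\<in>set js. c j k * ?w (Orig k) y)"
        using snoc.prems G[of i j] E[of i j] by auto
    qed auto
    then show ?case using snoc.IH[of "j # ls"] snoc.prems by simp
  qed simp
  from this[of "rev js" "[]"]
  have "pfl ?w (map Orig js @ map Dual (rev js)) = pfl ?w (map Orig js @ map Elim (rev js))"
    by simp
  also have "\<dots> = pfl ?w (map Orig js) * pfl ?w (map Elim (rev js))"
    by (rule pfl_orthogonal) auto
  finally show ?thesis by (simp add: pfl_map del: rev_map)
qed

theorem pfl_sum_subsets: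
  assumes alt: "alternating_form G" "alternating_form W" "alternating_form C" and js: "distinct js"
    and inv: "\<And>i j. i \<in> set js \<Longrightarrow> j \<in> set js \<Longrightarrow>
      (\<Sum>k\<in>set js. C i k * G k j) = (if i = j then 1 else 0)"
  shows "(\<Sum>K\<in>Pow (set js). pfl G (filter (\<lambda>i. i \<in> K) js) * pfl W (filter (\<lambda>i. i \<in> K) js)) =
    pfl G js * pfl (\<lambda>i j. W i j - C i j) js"
proof -
  \<comment> \<open>Both forms are negated because the \<open>Dual\<close> entries appear in
    reversed order, which cancels the sign.\<close>
  let ?V = "\<lambda>i j. - W i j" and ?F = "\<lambda>i j. - (W i j - C i j)"
  let ?E = "\<lambda>i j. if i = j then 1 else 0"
  define w where "w = node_form G ?E ?V ?F"
  note V = alternating_uminus[OF alt(2)]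
  note WC = alternating_diff[OF alt(2,3)]
  note F = alternating_uminus[OF WC]
  have altw: "alternating_form w"
    unfolding w_def using alt(1) V F by (rule alternating_node_form)
  have cut: "pfl w (dual_pairs Cut ks) = pfl G ks * pfl W ks" for ks
  proof -
    have "pfl w (dual_pairs Cut ks) = pfl w (map Cut ks @ map Dual (rev ks))"
      using pfl_dual_pairs[OF altw, of "[]" Cut ks "[]"] by simp
    also have "\<dots> = pfl w (map Cut ks) * pfl w (map Dual (rev ks))"
      by (rule pfl_orthogonal) (auto simp: w_def)
    also have "\<dots> = pfl G ks * pfl ?V (rev ks)" by (simp add: pfl_map w_def del: rev_map)
    finally show ?thesis by (simp add: pfl_rev_uminus[OF alt(2)])
  qed
  have "(\<Sum>K\<in>Pow (set js). pfl G (filter (\<lambda>i. i \<in> K) js) * pfl W (filter (\<lambda>i. i \<in> K) js)) =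
      (\<Sum>K\<in>Pow (set js). pfl w (dual_pairs Cut (filter (\<lambda>i. i \<in> K) js) @ []))"
    by (simp add: cut)
  also have "\<dots> = pfl w (dual_pairs Orig js @ [])"
    by (rule pfl_dual_pairs_expand[OF w_def altw js, symmetric]) simp
  also have "\<dots> = pfl w (map Orig js @ map Dual (rev js))"
    using pfl_dual_pairs[OF altw, of "[]" Orig js "[]"] by simp
  \<comment> \<open>The pairing is the identity, so adding the combination with coefficients
    \<open>C\<close> changes the form on the duals from \<open>- W\<close> to
    \<open>- W + C\<close>.\<close>
  also have "\<dots> = pfl G js * pfl ?F (rev js)"
    unfolding w_def using alt(1) V F
    by (rule pfl_elim[where c = C]) (auto simp: inv if_distrib cong: if_cong)
  also have "pfl ?F (rev js) = pfl (\<lambda>i j. W i j - C i j) js"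
    by (rule pfl_rev_uminus[OF WC])
  finally show ?thesis .
qed

text \<open>
  The matrix \<open>w\<close> is both the pairing and the form on the \<open>P\<^sub>i\<close>, and the \<open>Q\<^sub>i\<close> are isotropic, so the
  Pfaffian is \<open>det w\<close>; replacing \<open>Q\<^sub>i\<close> by \<open>Q\<^sub>i - P\<^sub>i\<close> splits it as \<open>Pf(w) Pf(w)\<close>.
\<close>

lemma det_eq_pfl_square:
  assumes w: "alternating_form w" and xs: "distinct xs"
  shows "det (mat (length xs) (length xs) (\<lambda>(i, j). w (xs ! i) (xs ! j))) = pfl w xs * pfl w xs"
proof -
  let ?n = "length xs" and ?V = "\<lambda>i j. 0" and ?F = "\<lambda>i j. - w i j"
  let ?w = "node_form w w ?V ?F"
  have V: "alternating_form ?V" by (simp add: alternating_form_def)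
  note F = alternating_uminus[OF w]
  have "pfl ?w (map Orig xs @ rev (map Dual xs)) =
      det (mat (length (map Dual xs)) (length (map Dual xs)) (\<lambda>(i, j). ?w (map Orig xs ! i) (map Dual xs ! j)))"
    by (rule pfl_isotropic_det) auto
  also have "\<dots> = det (mat ?n ?n (\<lambda>(i, j). w (xs ! i) (xs ! j)))"
    by (intro arg_cong[of _ _ det] eq_matI) auto
  finally have "det (mat ?n ?n (\<lambda>(i, j). w (xs ! i) (xs ! j))) = pfl ?w (map Orig xs @ map Dual (rev xs))"
    by (simp add: rev_map)
  also have "\<dots> = pfl w xs * pfl ?F (rev xs)"
  proof (rule pfl_elim[OF w V F, where c = "\<lambda>i j. if i = j then - 1 else 0"])
    fix i j assume ij: "i \<in> set xs" "j \<in> set xs"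
    have "(\<Sum>k\<in>set xs. (if j = k then - 1 else 0) * w k i) = (\<Sum>k\<in>set xs. if k = j then - w k i else 0)"
      by (rule sum.cong) auto
    also have "\<dots> = - w j i" using ij by simp
    finally have *: "(\<Sum>k\<in>set xs. (if j = k then - 1 else 0) * w k i) = - w j i" .
    then show "(\<Sum>k\<in>set xs. (if j = k then - 1 else 0) * w k i) = w i j"
      using alt_swap[OF w, of i j] by simp
    show "- w j i = 0 + (\<Sum>k\<in>set xs. (if j = k then - 1 else 0) * w k i)"
      using * by simp
  qed
  finally show ?thesis by (simp add: pfl_rev_uminus[OF w])
qed

section \<open>Skew-symmetric matrices\<close>

text \<open>The extension by zero makes the form of a skew-symmetric matrix alternating at all
  natural numbers, as \<open>alternating_form\<close> requires, and not only at valid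
  indices.\<close>

definition mat_form :: "'a mat \<Rightarrow> nat \<Rightarrow> nat \<Rightarrow> 'a::comm_ring_1" where
  "mat_form A i j = (if i < dim_row A \<and> j < dim_col A then A $$ (i, j) else 0)"

lemma alternating_mat_form:
  assumes "skew_symmetric_mat A"
  shows "alternating_form (mat_form A)"
proof -
  have dim: "dim_col A = dim_row A"
    and skew: "\<And>i j. i < dim_row A \<Longrightarrow> j < dim_row A \<Longrightarrow> A $$ (i, j) = - A $$ (j, i)"
    and diag: "\<And>i. i < dim_row A \<Longrightarrow> A $$ (i, i) = 0"
    using assms unfolding skew_symmetric_mat_def square_mat.simps by blast+
  have "mat_form A x y = - mat_form A y x" for x y
  proof (cases "x < dim_row A \<and> y < dim_row A")
    case True
    then have "mat_form A x y = A $$ (x, y)" "mat_form A y x = A $$ (y, x)"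
      by (simp_all add: mat_form_def dim)
    moreover have "A $$ (x, y) = - A $$ (y, x)" using True by (intro skew) auto
    ultimately show ?thesis by (simp only:)
  qed (auto simp: mat_form_def dim)
  moreover have "mat_form A x x = 0" for x
    using diag[of x] by (simp add: mat_form_def dim)
  ultimately show ?thesis unfolding alternating_form_def by blast
qed

lemma Pf_mat_form:
  assumes "A \<in> carrier_mat n n" "even n"
  shows "Pf A = pfl (mat_form A) [0..<n]"
  using assms Pf_eq_pfl[of A] by (auto simp: mat_form_def intro!: pfl_cong)

lemma Pf_submatrix_mat_form:
  assumes "A \<in> carrier_mat n n" and "even (card {i. i < n \<and> i \<in> P})"
  shows "Pf (submatrix A P P) = pfl (mat_form A) (filter (\<lambda>i. i \<in> P) [0..<n])"
  using assms Pf_submatrix[OF assms] by (auto simp: mat_form_def intro!: pfl_cong)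

lemma det_eq_Pf_square:
  assumes "A \<in> carrier_mat n n" "even n" "skew_symmetric_mat A"
  shows "det A = Pf A * Pf A"
proof -
  have "A = mat n n (\<lambda>(i, j). mat_form A ([0..<n] ! i) ([0..<n] ! j))"
    using assms(1) by (intro eq_matI) (auto simp: mat_form_def)
  then show ?thesis
    using det_eq_pfl_square[OF alternating_mat_form[OF assms(3)], of "[0..<n]"] Pf_mat_form[OF assms(1,2)]
    by simp
qed

text \<open>An inverse forces a nonzero determinant, which is the square of the Pfaffian.\<close>

lemma Pf_nonzero:
  fixes A :: "'k::field mat"
  assumes "A \<in> carrier_mat n n" "even n" "skew_symmetric_mat A" "invertible_mat A"
  shows "Pf A \<noteq> 0"
proof -
  obtain B where B: "A * B = 1\<^sub>m (dim_row A)" "B * A = 1\<^sub>m (dim_row B)"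
    using assms(4) unfolding invertible_mat_def inverts_mat_def by blast
  then have "B \<in> carrier_mat n n"
    using assms(1) by (metis carrier_matD carrier_matI index_mult_mat(2,3) index_one_mat(2,3))
  then have "det A * det B = 1"
    using B(1) det_mult[OF assms(1), of B] assms(1) by simp
  then have "det A \<noteq> 0" by auto
  then show ?thesis using det_eq_Pf_square[OF assms(1-3)] by simp
qed

lemma del_nth_distinct:
  assumes "distinct xs" "j < length xs"
  shows "del_nth j xs = filter (\<lambda>x. x \<noteq> xs ! j) xs"
proof -
  have xs: "xs = take j xs @ xs ! j # drop (Suc j) xs"
    using assms(2) by (rule id_take_nth_drop)
  then have "distinct (take j xs @ xs ! j # drop (Suc j) xs)" using assms(1) by simp
  then have "\<forall>x\<in>set (take j xs). x \<noteq> xs ! j" "\<forall>x\<in>set (drop (Suc j) xs). x \<noteq> xs ! j"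
    by auto
  then have "filter (\<lambda>x. x \<noteq> xs ! j) (take j xs @ xs ! j # drop (Suc j) xs) = del_nth j xs"
    by (simp add: del_nth_def)
  then show ?thesis using xs by simp
qed

section \<open>The copfaffian matrix as a Pfaffian adjugate\<close>

lemma copfaffian_mat_dim [simp]:
  "dim_row (copfaffian_mat A) = dim_row A" "dim_col (copfaffian_mat A) = dim_row A"
  by (simp_all add: copfaffian_mat_def)

lemma alternating_copfaffian_mat: "alternating_form (mat_form (copfaffian_mat A))"
proof -
  have "mat_form (copfaffian_mat A) x y = - mat_form (copfaffian_mat A) y x" for x y
    by (auto simp: mat_form_def copfaffian_mat_def Let_def insert_commute add.commute)
  moreover have "mat_form (copfaffian_mat A) x x = 0" for x
    by (simp add: mat_form_def copfaffian_mat_def)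
  ultimately show ?thesis unfolding alternating_form_def by blast
qed

text \<open>When the second index is counted as position \<open>m\<close> among those different from
  \<open>j\<close>, the cases \<open>k < j\<close> and \<open>j < k\<close> have the same sign: the
  off-by-one between \<open>k\<close> and \<open>m\<close> absorbs the sign change across the
  diagonal.\<close>

lemma copfaffian_mat_pfl:
  assumes A: "A \<in> carrier_mat n n" "even n" and j: "j < n" and m: "m < n - 1"
  defines "k \<equiv> del_nth j [0..<n] ! m"
  shows "mat_form (copfaffian_mat A) j k =
    (-1) ^ (j + m) * pfl (mat_form A) (del_nth m (del_nth j [0..<n]))"
proof -
  have k: "k = (if m < j then m else Suc m)"
    using j m by (auto simp: k_def nth_del_nth)
  then have kn: "k < n" "k \<noteq> j" using m by auto
  have len: "length (del_nth j [0..<n]) = n - 1" using j by (simp add: length_del_nth)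
  have dj: "del_nth j [0..<n] = filter (\<lambda>x. x \<noteq> j) [0..<n]"
    using j by (subst del_nth_distinct) auto
  have dist: "distinct (del_nth j [0..<n])" unfolding dj by simp
  have "del_nth m (del_nth j [0..<n]) = filter (\<lambda>x. x \<noteq> k) (del_nth j [0..<n])"
    using del_nth_distinct[OF dist, of m] m len by (simp add: k_def)
  also have "\<dots> = filter (\<lambda>x. x \<in> - {j, k}) [0..<n]"
    unfolding dj by (simp add: conj_commute)
  finally have list: "del_nth m (del_nth j [0..<n]) = filter (\<lambda>x. x \<in> - {j, k}) [0..<n]" .
  have "{i. i < n \<and> i \<in> - {j, k}} = {..<n} - {j, k}" by auto
  then have "even (card {i. i < n \<and> i \<in> - {j, k}})"
    using j kn A(2) by (simp add: card_Diff_subset)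
  then have sub: "Pf (submatrix A (- {j, k}) (- {j, k})) = pfl (mat_form A) (del_nth m (del_nth j [0..<n]))"
    using Pf_submatrix_mat_form[OF A(1)] list by simp
  show ?thesis
    using A(1) j kn k sub by (auto simp: mat_form_def copfaffian_mat_def Let_def)
qed

text \<open>Up to the sign \<open>(-1) ^ j\<close>, the sum expands the Pfaffian of the list in
  which \<open>j\<close> is deleted and \<open>i\<close> put in front. For \<open>i = j\<close> this
  is a reordering of all indices, otherwise \<open>i\<close> is repeated and the value is 0.\<close>

lemma copfaffian_mat_mult:
  assumes A: "A \<in> carrier_mat n n" "even n" "skew_symmetric_mat A" and ij: "i < n" "j < n"
  shows "(\<Sum>k<n. mat_form (copfaffian_mat A) j k * mat_form A i k) = (if i = j then Pf A else 0)"
proof -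
  let ?a = "mat_form A" and ?c = "mat_form (copfaffian_mat A)"
  note alt = alternating_mat_form[OF A(3)]
  have xs: "[0..<n] = take j [0..<n] @ j # drop (Suc j) [0..<n]"
    using ij id_take_nth_drop[of j "[0..<n]"] by simp
  have del: "del_nth j [0..<n] = filter (\<lambda>x. x \<noteq> j) [0..<n]"
    using ij by (subst del_nth_distinct) auto
  have len: "length (del_nth j [0..<n]) = n - 1" using ij by (simp add: length_del_nth)
  \<comment> \<open>The term \<open>k = j\<close> drops out because the copfaffian matrix has zero
    diagonal.\<close>
  have "(\<Sum>k<n. ?c j k * ?a i k) = (\<Sum>k\<in>set (del_nth j [0..<n]). ?c j k * ?a i k)"
    unfolding del using ij
    by (intro sum.mono_neutral_right) (auto simp: mat_form_def copfaffian_mat_def)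
  also have "\<dots> = (\<Sum>m<n - 1. ?c j (del_nth j [0..<n] ! m) * ?a i (del_nth j [0..<n] ! m))"
  proof (rule sum.reindex_bij_betw[symmetric])
    have "distinct (del_nth j [0..<n])" unfolding del by simp
    then show "bij_betw ((!) (del_nth j [0..<n])) {..<n - 1} (set (del_nth j [0..<n]))"
      using len by (intro bij_betw_nth) auto
  qed
  also have "\<dots> = (\<Sum>m<n - 1. (-1) ^ j * ((-1) ^ m * ?a i (del_nth j [0..<n] ! m) *
      pfl ?a (del_nth m (del_nth j [0..<n]))))"
    using ij by (intro sum.cong) (auto simp: copfaffian_mat_pfl[OF A(1,2)] power_add)
  also have "\<dots> = (-1) ^ j * pfl ?a (i # del_nth j [0..<n])"
    by (simp add: sum_distrib_left len)
  also have "\<dots> = (if i = j then Pf A else 0)"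
  proof (cases "i = j")
    case True
    have "pfl ?a [0..<n] = (-1) ^ j * pfl ?a (j # del_nth j [0..<n])"
      using pfl_move[OF alt, of "take j [0..<n]" j "drop (Suc j) [0..<n]"] xs ij
      by (simp add: del_nth_def del: pfl.simps)
    then show ?thesis using True Pf_mat_form[OF A(1,2)] by simp
  next
    case False
    then show ?thesis using pfl_repeated[OF alt, of i "del_nth j [0..<n]"] ij
      by (simp add: del del: pfl.simps)
  qed
  finally show ?thesis .
qed

section \<open>The bipartite case\<close>

fun block_form ::
  "('i \<Rightarrow> 'i \<Rightarrow> 'r) \<Rightarrow> ('j \<Rightarrow> 'j \<Rightarrow> 'r) \<Rightarrow> ('i \<Rightarrow> 'j \<Rightarrow> 'r) \<Rightarrow> 'i + 'j \<Rightarrow> 'i + 'j \<Rightarrow> 'r::comm_ring_1"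
where
  "block_form a b h (Inl i) (Inl j) = a i j"
| "block_form a b h (Inr i) (Inr j) = b i j"
| "block_form a b h (Inl i) (Inr j) = h i j"
| "block_form a b h (Inr i) (Inl j) = - h j i"

lemma alternating_block_form:
  assumes "alternating_form a" "alternating_form b"
  shows "alternating_form (block_form a b h)"
  unfolding alternating_form_def
proof (intro conjI allI)
  show "block_form a b h x x = 0" for x
    using assms by (cases x) (simp_all add: alt_self)
  show "block_form a b h x y = - block_form a b h y x" for x y
    by (cases x; cases y) (simp_all, (rule alt_swap, rule assms)+)
qed

lemma sum_Pow_Plus:
  assumes "finite X" "finite Y"
  shows "(\<Sum>K\<in>Pow (Inl ` X \<union> Inr ` Y). f K) = (\<Sum>I\<in>Pow X. \<Sum>J\<in>Pow Y. f (Inl ` I \<union> Inr ` J))"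
proof -
  have "(\<Sum>K\<in>Pow (Inl ` X \<union> Inr ` Y). f K) = (\<Sum>(I, J)\<in>Pow X \<times> Pow Y. f (Inl ` I \<union> Inr ` J))"
  proof (rule sum.reindex_bij_witness[where i = "\<lambda>(I, J). Inl ` I \<union> Inr ` J"
        and j = "\<lambda>K. (Inl -` K, Inr -` K)"])
    fix K :: "('a + 'b) set"
    have "x \<in> Inl ` (Inl -` K) \<union> Inr ` (Inr -` K) \<longleftrightarrow> x \<in> K" for x
      by (cases x) auto
    then have "Inl ` (Inl -` K) \<union> Inr ` (Inr -` K) = K" by blast
    then show "(case (Inl -` K, Inr -` K) of (I, J) \<Rightarrow> Inl ` I \<union> Inr ` J) = K"
      and "(case (Inl -` K, Inr -` K) of (I, J) \<Rightarrow> f (Inl ` I \<union> Inr ` J)) = f K"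
      by simp_all
  qed auto
  then show ?thesis by (simp add: sum.cartesian_product)
qed

text \<open>Applies \<open>pfl_sum_subsets\<close> to labels of two kinds, whose subsets are pairs
  \<open>(I, J)\<close>. \<open>G\<close> is block diagonal, so its Pfaffians factor;
  \<open>W\<close> is purely off-diagonal, so its Pfaffians are minors of \<open>h\<close> and
  vanish unless \<open>I\<close> and \<open>J\<close> have equal size.\<close>

theorem pfl_sum_subsets_bipartite:
  fixes h :: "'i \<Rightarrow> 'j \<Rightarrow> 'r::comm_ring_1"
  assumes alt: "alternating_form a" "alternating_form b" "alternating_form a'" "alternating_form b'"
    and dist: "distinct xs" "distinct ys"
    and inva: "\<And>i j. i \<in> set xs \<Longrightarrow> j \<in> set xs \<Longrightarrow> (\<Sum>k\<in>set xs. a' i k * a j k) = (if i = j then 1 else 0)"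
    and invb: "\<And>i j. i \<in> set ys \<Longrightarrow> j \<in> set ys \<Longrightarrow> (\<Sum>k\<in>set ys. b' i k * b j k) = (if i = j then 1 else 0)"
  shows "(\<Sum>I\<in>Pow (set xs). \<Sum>J\<in>Pow (set ys).
      let xI = filter (\<lambda>i. i \<in> I) xs; yJ = filter (\<lambda>j. j \<in> J) ys in
      if length xI = length yJ
      then pfl a xI * pfl b yJ * det (mat (length xI) (length xI) (\<lambda>(i, j). h (xI ! i) (yJ ! j)))
      else 0) =
    pfl a xs * pfl b ys * pfl (block_form a' (\<lambda>i j. - b' i j) h) (map Inl xs @ map Inr (rev ys))"
proof -
  let ?zs = "map Inl xs @ map Inr (rev ys)"
  define G where "G = block_form a (\<lambda>i j. - b i j) (\<lambda>_ _. 0)"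
  define W where "W = block_form (\<lambda>_ _. 0) (\<lambda>_ _. 0) h"
  \<comment> \<open>\<open>C\<close> is the inverse of \<open>G\<close>. The hypotheses multiply by
    the transposes of \<open>a\<close> and \<open>b\<close>, which are their negatives; this fixes
    the signs of the two blocks.\<close>
  define C where "C = block_form (\<lambda>i j. - a' i j) b' (\<lambda>_ _. 0)"
  have zero: "alternating_form (\<lambda>_ _. 0)" by (simp add: alternating_form_def)
  have G: "alternating_form G" and W: "alternating_form W" and C: "alternating_form C"
    unfolding G_def W_def C_def
    by (intro alternating_block_form alternating_uminus zero alt)+
  have set: "set ?zs = Inl ` set xs \<union> Inr ` set ys" by simp
  have sum: "(\<Sum>k\<in>set ?zs. f k) = (\<Sum>i\<in>set xs. f (Inl i)) + (\<Sum>j\<in>set ys. f (Inr j))" for f :: "'i + 'j \<Rightarrow> 'r"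
    unfolding set by (subst sum.union_disjoint) (auto simp: sum.reindex)
  have inv: "(\<Sum>k\<in>set ?zs. C x k * G k y) = (if x = y then 1 else 0)"
    if "x \<in> set ?zs" "y \<in> set ?zs" for x y
  proof -
    have A: "(\<Sum>k\<in>set xs. - a' i k * a k j) = (\<Sum>k\<in>set xs. a' i k * a j k)" for i j
    proof (rule sum.cong)
      show "- a' i k * a k j = a' i k * a j k" for k
        by (subst alt_swap[OF alt(1), of k j]) simp
    qed simp
    have B: "(\<Sum>k\<in>set ys. b' i k * - b k j) = (\<Sum>k\<in>set ys. b' i k * b j k)" for i j
    proof (rule sum.cong)
      show "b' i k * - b k j = b' i k * b j k" for k
        by (subst alt_swap[OF alt(2), of k j]) simp
    qed simp
    show ?thesis
    proof (cases x; cases y)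
      fix i j assume "x = Inl i" "y = Inl j"
      then show ?thesis using that A[of i j] inva[of i j] by (simp only: sum) (auto simp: G_def C_def)
    next
      fix i j assume "x = Inr i" "y = Inr j"
      then show ?thesis using that B[of i j] invb[of i j] by (simp only: sum) (auto simp: G_def C_def)
    qed (simp_all only: sum, auto simp: G_def C_def)
  qed
  \<comment> \<open>The reversed order of the second list undoes the minus sign in front of
    \<open>b\<close>.\<close>
  have Gsplit: "pfl G (map Inl us @ map Inr (rev vs)) = pfl a us * pfl b vs" for us vs
  proof -
    have "pfl G (map Inl us @ map Inr (rev vs)) = pfl G (map Inl us) * pfl G (map Inr (rev vs))"
      by (rule pfl_orthogonal) (auto simp: G_def)
    also have "\<dots> = pfl a us * pfl (\<lambda>i j. - b i j) (rev vs)"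
      by (simp add: pfl_map G_def del: rev_map)
    finally show ?thesis by (simp add: pfl_rev_uminus[OF alt(2)])
  qed
  have Wdet: "pfl W (map Inl us @ map Inr (rev vs)) =
      (if length us = length vs
       then det (mat (length us) (length us) (\<lambda>(i, j). h (us ! i) (vs ! j))) else 0)" for us vs
  proof (cases "length us" "length vs" rule: linorder_cases)
    case equal
    have "W x y = 0" if "x \<in> set (map Inr vs)" "y \<in> set (map Inr vs)" for x y
      using that by (auto simp: W_def)
    moreover have "length (map Inl us :: ('i + 'j) list) = length (map Inr vs :: ('i + 'j) list)"
      using equal by simp
    ultimately have "pfl W (map Inl us @ rev (map Inr vs)) =
        det (mat (length (map Inr vs :: ('i + 'j) list)) (length (map Inr vs :: ('i + 'j) list))
          (\<lambda>(i, j). W (map Inl us ! i) (map Inr vs ! j)))"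
      by (rule pfl_isotropic_det)
    also have "\<dots> = det (mat (length us) (length us) (\<lambda>(i, j). h (us ! i) (vs ! j)))"
      using equal by (intro arg_cong[of _ _ det] eq_matI) (auto simp: W_def)
    finally show ?thesis using equal by (simp add: rev_map)
  next
    case less
    then show ?thesis by (subst pfl_isotropic_right) (auto simp: W_def)
  next
    case greater
    then show ?thesis by (subst pfl_isotropic_left[OF W]) (auto simp: W_def)
  qed
  have filt: "filter (\<lambda>k. k \<in> Inl ` I \<union> Inr ` J) ?zs =
      map Inl (filter (\<lambda>i. i \<in> I) xs) @ map Inr (rev (filter (\<lambda>j. j \<in> J) ys))" for I J
    by (auto simp: filter_map o_def rev_filter[symmetric] image_iff intro!: arg_cong2[of _ _ _ _ "(@)"] filter_cong)
  have "(\<Sum>I\<in>Pow (set xs). \<Sum>J\<in>Pow (set ys).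
      let xI = filter (\<lambda>i. i \<in> I) xs; yJ = filter (\<lambda>j. j \<in> J) ys in
      if length xI = length yJ
      then pfl a xI * pfl b yJ * det (mat (length xI) (length xI) (\<lambda>(i, j). h (xI ! i) (yJ ! j)))
      else 0) = (\<Sum>I\<in>Pow (set xs). \<Sum>J\<in>Pow (set ys).
      (let K = Inl ` I \<union> Inr ` J in
        pfl G (filter (\<lambda>k. k \<in> K) ?zs) * pfl W (filter (\<lambda>k. k \<in> K) ?zs)))"
    by (intro sum.cong refl) (simp only: Let_def filt Gsplit Wdet mult_zero_right if_distrib[of "(*) _"])
  also have "\<dots> = (\<Sum>K\<in>Pow (set ?zs).
      pfl G (filter (\<lambda>k. k \<in> K) ?zs) * pfl W (filter (\<lambda>k. k \<in> K) ?zs))"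
    unfolding set Let_def by (rule sum_Pow_Plus[symmetric]) auto
  also have "\<dots> = pfl G ?zs * pfl (\<lambda>x y. W x y - C x y) ?zs"
    by (rule pfl_sum_subsets[OF G W C _ inv]) (use dist in \<open>auto simp: distinct_map\<close>)
  also have "(\<lambda>x y. W x y - C x y) = block_form a' (\<lambda>i j. - b' i j) h"
  proof (intro ext)
    show "W x y - C x y = block_form a' (\<lambda>i j. - b' i j) h x y" for x y
      by (cases x; cases y) (simp_all add: W_def C_def)
  qed
  finally show ?thesis unfolding Gsplit .
qed

section \<open>The Lindstroem-Gessel-Viennot lemma\<close>

locale acyclic_wf_digraph = wf_digraph +
  assumes acyclic: "acyclic_digraph G"
begin

section \<open>Cutting and splicing walks at a vertex\<close>

lemma distinct_awalk_verts:
  assumes "awalk u p v"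
  shows "distinct (awalk_verts u p)"
proof (rule ccontr)
  assume "\<not> distinct (awalk_verts u p)"
  then obtain q where "closed_w q"
    using awalk_not_distinct_decomp[OF assms] unfolding closed_w_def by blast
  then show False
    using acyclic closed_w_imp_cycle unfolding acyclic_digraph_def by blast
qed

text \<open>Every walk is a path here, so spliced walks are paths without a check for repeated
  vertices.\<close>

lemma paths_eq: "paths G u v = {p. awalk u p v}"
  unfolding paths_def apath_def using distinct_awalk_verts by blast

text \<open>The cut is made at the first arc leaving \<open>x\<close>. If \<open>x\<close> is the
  end of the path, no arc leaves it: \<open>before\<close> is the whole path and
  \<open>after\<close> is empty, as it should be.\<close>

abbreviation before :: "'a \<Rightarrow> 'b list \<Rightarrow> 'b list" where
  "before x \<equiv> takeWhile (\<lambda>e. tail G e \<noteq> x)"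

abbreviation after :: "'a \<Rightarrow> 'b list \<Rightarrow> 'b list" where
  "after x \<equiv> dropWhile (\<lambda>e. tail G e \<noteq> x)"

text \<open>The second part is empty or begins with an arc leaving \<open>x\<close>, so cutting a
  spliced list at \<open>x\<close> returns its two pieces. Hence two tail swaps at the same vertex
  cancel.\<close>

lemma before_append_after [simp]:
  "before x (before x p @ after x q) = before x p"
  "after x (before x p @ after x q) = after x q"
proof -
  have b: "\<forall>e\<in>set (before x p). tail G e \<noteq> x" by (auto dest: set_takeWhileD)
  have "before x (before x p @ after x q) = before x p \<and> after x (before x p @ after x q) = after x q"
  proof (cases "after x q")
    case Nil
    show ?thesis using b unfolding Nil by (simp add: takeWhile_eq_all_conv dropWhile_eq_Nil_conv)
  next
    case (Cons e es)
    then have "tail G e = x" using hd_dropWhile[of "\<lambda>e. tail G e \<noteq> x" q] by simp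
    then show ?thesis using b unfolding Cons by (simp add: takeWhile_append2 dropWhile_append2)
  qed
  then show "before x (before x p @ after x q) = before x p" "after x (before x p @ after x q) = after x q"
    by blast+
qed

lemma awalk_cut:
  assumes "awalk u p v" "x \<in> set (awalk_verts u p)"
  shows "awalk u (before x p) x" "awalk x (after x p) v"
proof -
  obtain q r where p: "p = q @ r" "awalk u q x" "awalk x r v"
    using awalk_decomp[OF assms] by blast
  have "distinct (awalk_verts u q)" using p(2) by (rule distinct_awalk_verts)
  then have "\<forall>e\<in>set q. tail G e \<noteq> x"
    using awlast_of_awalk[OF p(2)] p(2) unfolding awalk_verts_conv
    by (auto simp: image_iff split: if_splits)
  moreover have "r = [] \<or> tail G (hd r) = x"
    using p(3) by (cases r) (auto simp: awalk_Cons_iff)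
  ultimately have "before x p = q" "after x p = r"
    unfolding p(1) by (cases r; simp add: takeWhile_append2 dropWhile_append2)+
  then show "awalk u (before x p) x" "awalk x (after x p) v" using p by simp_all
qed

text \<open>The vertex \<open>x\<close> ends one half and starts the other, and \<open>tl\<close>
  drops its second copy. Together with the analogous formula for splices this shows that exchanging
  tails preserves the total vertex multiset.\<close>

lemma mset_awalk_verts_cut:
  assumes "awalk u p v" "x \<in> set (awalk_verts u p)"
  shows "mset (awalk_verts u p) =
    mset (awalk_verts u (before x p)) + mset (tl (awalk_verts x (after x p)))"
proof -
  have "awalk_verts u (before x p @ after x p) =
      awalk_verts u (before x p) @ tl (awalk_verts (awlast u (before x p)) (after x p))"
    using assms(1) by (intro awalk_verts_append) simp
  then show ?thesis using awalk_cut(1)[OF assms] by simp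
qed

lemma mset_awalk_verts_splice:
  assumes "awalk u p v" "x \<in> set (awalk_verts u p)" "awalk u' p' v'" "x \<in> set (awalk_verts u' p')"
  shows "awalk u (before x p @ after x p') v'"
    and "mset (awalk_verts u (before x p @ after x p')) =
      mset (awalk_verts u (before x p)) + mset (tl (awalk_verts x (after x p')))"
    and "x \<in> set (awalk_verts u (before x p @ after x p'))"
proof -
  show walk: "awalk u (before x p @ after x p') v'"
    using awalk_cut(1)[OF assms(1,2)] awalk_cut(2)[OF assms(3,4)] by (rule awalk_appendI)
  have last: "awlast u (before x p) = x" using awalk_cut(1)[OF assms(1,2)] by simp
  have "awalk_verts u (before x p @ after x p') =
      awalk_verts u (before x p) @ tl (awalk_verts (awlast u (before x p)) (after x p'))"
    using walk by (rule awalk_verts_append)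
  then have eq: "awalk_verts u (before x p @ after x p') =
      awalk_verts u (before x p) @ tl (awalk_verts x (after x p'))"
    by (simp only: last)
  then show "mset (awalk_verts u (before x p @ after x p')) =
      mset (awalk_verts u (before x p)) + mset (tl (awalk_verts x (after x p')))" by simp
  have "awlast u (before x p) \<in> set (awalk_verts u (before x p))" by (rule last_in_set) simp
  then have "x \<in> set (awalk_verts u (before x p))" by (simp only: last)
  then show "x \<in> set (awalk_verts u (before x p @ after x p'))" by (simp add: eq)
qed

section \<open>Path families and the sign-reversing exchange of tails\<close>

context
  fixes r :: nat and u v :: "nat \<Rightarrow> 'a"
begin

text \<open>Paths are indexed by their starting points and \<open>\<tau>\<close> permutes the end
  points. The functions are extensional, so that a family is determined by its \<open>r\<close>
  paths and there are finitely many.\<close>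

definition families :: "((nat \<Rightarrow> nat) \<times> (nat \<Rightarrow> 'b list)) set" where
  "families = {(\<tau>, f). \<tau> permutes {..<r} \<and> f \<in> (\<Pi>\<^sub>E k\<in>{..<r}. paths G (u k) (v (\<tau> k)))}"

definition vertex_mset :: "(nat \<Rightarrow> 'b list) \<Rightarrow> 'a multiset" where
  "vertex_mset f = (\<Sum>k<r. mset (awalk_verts (u k) (f k)))"

definition hits :: "'a \<Rightarrow> (nat \<Rightarrow> 'b list) \<Rightarrow> nat set" where
  "hits x f = {k. k < r \<and> x \<in> set (awalk_verts (u k) (f k))}"

definition crossings :: "(nat \<Rightarrow> 'b list) \<Rightarrow> 'a set" where
  "crossings f = {x. 2 \<le> count (vertex_mset f) x}"

definition swap_tails ::
  "'a \<Rightarrow> nat \<Rightarrow> nat \<Rightarrow> (nat \<Rightarrow> nat) \<times> (nat \<Rightarrow> 'b list) \<Rightarrow> (nat \<Rightarrow> nat) \<times> (nat \<Rightarrow> 'b list)" where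
  "swap_tails x i j = (\<lambda>(\<tau>, f). (\<tau> \<circ> transpose i j,
     f(i := before x (f i) @ after x (f j), j := before x (f j) @ after x (f i))))"

text \<open>
  The crossing vertex and the two paths are read off from the multiset of all vertices of the
  family and from the set of paths through that vertex. Swapping tails changes neither, so the
  swap is an involution without comparing positions along the paths.
\<close>

definition switch ::
  "(nat \<Rightarrow> nat) \<times> (nat \<Rightarrow> 'b list) \<Rightarrow> (nat \<Rightarrow> nat) \<times> (nat \<Rightarrow> 'b list)" where
  "switch = (\<lambda>(\<tau>, f).
     let x = (SOME x. x \<in> crossings f);
         i = Min (hits x f);
         j = Min (hits x f - {i})
     in swap_tails x i j (\<tau>, f))"

lemma finite_hits: "finite (hits x f)"
  unfolding hits_def by simp

text \<open>A path visits a vertex at most once, so the multiplicity of \<open>x\<close> is the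
  number of paths through it.\<close>

lemma count_vertex_mset:
  assumes "(\<tau>, f) \<in> families"
  shows "count (vertex_mset f) x = card (hits x f)"
proof -
  have "count (mset (awalk_verts (u k) (f k))) x =
      (if x \<in> set (awalk_verts (u k) (f k)) then 1 else 0)" if "k < r" for k
  proof -
    have "awalk (u k) (f k) (v (\<tau> k))"
      using assms that by (auto simp: families_def paths_eq)
    then have "distinct (awalk_verts (u k) (f k))" by (rule distinct_awalk_verts)
    then show ?thesis unfolding distinct_count_atmost_1 by blast
  qed
  then have "count (vertex_mset f) x =
      (\<Sum>k<r. if x \<in> set (awalk_verts (u k) (f k)) then 1 else 0)"
    by (simp add: vertex_mset_def count_sum)
  also have "\<dots> = card (hits x f)"
    by (simp add: hits_def sum.If_cases Int_def)
  finally show ?thesis .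
qed

lemma crossings_eq:
  assumes "(\<tau>, f) \<in> families"
  shows "crossings f = {x. 2 \<le> card (hits x f)}"
  unfolding crossings_def using count_vertex_mset[OF assms] by simp

text \<open>Pieces are only redistributed between the paths \<open>i\<close> and \<open>j\<close>,
  so the vertex multiset and the weight are preserved, and both new paths still pass through
  \<open>x\<close>. Their end points are exchanged, which composes \<open>\<tau>\<close> with a
  transposition.\<close>

lemma swap_tails:
  assumes f: "(\<tau>, f) \<in> families" and ij: "i \<in> hits x f" "j \<in> hits x f" "i \<noteq> j"
    and swap: "swap_tails x i j (\<tau>, f) = (\<tau>', f')"
  shows "(\<tau>', f') \<in> families" "vertex_mset f' = vertex_mset f" "hits x f' = hits x f"
    "swap_tails x i j (\<tau>', f') = (\<tau>, f)" "sign \<tau>' = - sign \<tau>"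
    "(\<Prod>k<r. path_weight w (f' k)) = (\<Prod>k<r. path_weight w (f k) :: 'c::comm_ring_1)"
proof -
  have \<tau>': "\<tau>' = \<tau> \<circ> transpose i j"
    and f': "f' = f(i := before x (f i) @ after x (f j), j := before x (f j) @ after x (f i))"
    using swap by (simp_all add: swap_tails_def)
  have f'ij: "f' i = before x (f i) @ after x (f j)" "f' j = before x (f j) @ after x (f i)"
    "\<And>k. k \<noteq> i \<Longrightarrow> k \<noteq> j \<Longrightarrow> f' k = f k"
    using ij(3) by (simp_all add: f')
  have r: "i < r" "j < r" and x: "x \<in> set (awalk_verts (u i) (f i))" "x \<in> set (awalk_verts (u j) (f j))"
    using ij by (auto simp: hits_def)
  have perm: "\<tau> permutes {..<r}" using f by (simp add: families_def)
  have walk: "awalk (u k) (f k) (v (\<tau> k))" if "k < r" for k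
    using f that by (auto simp: families_def paths_eq)
  note wi = walk[OF r(1)] x(1) and wj = walk[OF r(2)] x(2)
  note si = mset_awalk_verts_splice[OF wi wj] and sj = mset_awalk_verts_splice[OF wj wi]
  have perm': "\<tau>' permutes {..<r}"
    unfolding \<tau>' using r by (intro permutes_compose[OF _ perm] permutes_swap_id) auto
  have "f' k \<in> paths G (u k) (v (\<tau>' k))" if "k < r" for k
    using that si(1) sj(1) walk[of k] ij(3)
    by (cases "k = i"; cases "k = j") (auto simp: f'ij paths_eq \<tau>' transpose_apply_other)
  moreover have "f' \<in> extensional {..<r}"
    using f r by (auto simp: families_def f' PiE_def extensional_def)
  ultimately show "(\<tau>', f') \<in> families"
    using perm' by (auto simp: families_def PiE_def Pi_def)
  have split: "{..<r} = insert i (insert j ({..<r} - {i, j}))" using r by auto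
  have "(\<Sum>k\<in>{..<r} - {i, j}. mset (awalk_verts (u k) (f' k))) =
      (\<Sum>k\<in>{..<r} - {i, j}. mset (awalk_verts (u k) (f k)))"
    by (rule sum.cong) (auto simp: f'ij)
  then show "vertex_mset f' = vertex_mset f"
    unfolding vertex_mset_def using ij(3) si(2) sj(2)
      mset_awalk_verts_cut[OF wi] mset_awalk_verts_cut[OF wj]
    by (subst (1 2) split) (simp add: f'ij)
  show "hits x f' = hits x f"
    using si(3) sj(3) x r unfolding hits_def
    by (auto simp: f')
  show "swap_tails x i j (\<tau>', f') = (\<tau>, f)"
    using ij(3) by (auto simp: swap_tails_def \<tau>' f'ij comp_assoc fun_eq_iff)
  have "permutation \<tau>" using perm by (rule permutation_permutes[THEN iffD2, OF exI[of _ "{..<r}"], OF conjI, rotated]) simp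
  then show "sign \<tau>' = - sign \<tau>"
    using ij(3) by (simp add: \<tau>' sign_compose permutation_swap_id sign_swap_id)
  have "(\<Prod>k\<in>{..<r} - {i, j}. path_weight w (f' k)) = (\<Prod>k\<in>{..<r} - {i, j}. path_weight w (f k))"
    by (rule prod.cong) (auto simp: f'ij)
  moreover have "path_weight w (before x p) * path_weight w (after x p) = path_weight w p" for p
    unfolding path_weight_def by (metis map_append prod_list.append takeWhile_dropWhile_id)
  moreover have "path_weight w (p @ q) = path_weight w p * path_weight w q" for p q
    by (simp add: path_weight_def)
  then have "path_weight w (f' i) * path_weight w (f' j) =
      (path_weight w (before x (f i)) * path_weight w (after x (f i))) *
      (path_weight w (before x (f j)) * path_weight w (after x (f j)))"
    by (simp only: f'ij mult_ac)
  ultimately show "(\<Prod>k<r. path_weight w (f' k)) = (\<Prod>k<r. path_weight w (f k))"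
    using ij(3) by (subst (1 2) split) (simp add: mult.assoc[symmetric])
qed

lemma switch:
  assumes f: "(\<tau>, f) \<in> families" "crossings f \<noteq> {}" and switch: "switch (\<tau>, f) = (\<tau>', f')"
  shows "(\<tau>', f') \<in> families" "crossings f' \<noteq> {}" "switch (\<tau>', f') = (\<tau>, f)" "sign \<tau>' = - sign \<tau>"
    "(\<Prod>k<r. path_weight w (f' k)) = (\<Prod>k<r. path_weight w (f k) :: 'c::comm_ring_1)"
proof -
  define x where "x = (SOME x. x \<in> crossings f)"
  define i where "i = Min (hits x f)"
  define j where "j = Min (hits x f - {i})"
  have "x \<in> crossings f" unfolding x_def using f(2) by (rule some_in_eq[THEN iffD2])
  then have card: "2 \<le> card (hits x f)" using crossings_eq[OF f(1)] by simp
  then have i: "i \<in> hits x f" unfolding i_def by (intro Min_in finite_hits) auto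
  then have "card (hits x f - {i}) \<ge> 1" using card finite_hits by (simp add: card_Diff_singleton)
  then have "hits x f - {i} \<noteq> {}" by (metis card.empty not_one_le_zero)
  then have "j \<in> hits x f - {i}" unfolding j_def using finite_hits by (intro Min_in) simp_all
  then have j: "j \<in> hits x f" "i \<noteq> j" by auto
  have swap: "swap_tails x i j (\<tau>, f) = (\<tau>', f')"
    using switch by (simp add: switch_def Let_def x_def i_def j_def)
  note * = swap_tails[OF f(1) i j swap]
  show "(\<tau>', f') \<in> families" by (rule *(1))
  have cr: "crossings f' = crossings f" unfolding crossings_def *(2) ..
  then show "crossings f' \<noteq> {}" using f(2) by simp
  show "switch (\<tau>', f') = (\<tau>, f)"
    using *(4) by (simp add: switch_def Let_def cr x_def[symmetric] *(3) i_def[symmetric] j_def[symmetric])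
  show "sign \<tau>' = - sign \<tau>" by (rule *(5))
  show "(\<Prod>k<r. path_weight w (f' k)) = (\<Prod>k<r. path_weight w (f k))" by (rule *(6))
qed

text \<open>\<open>switch\<close> is a weight-preserving bijection between the crossing families of
  sign 1 and those of sign -1. Comparing the two halves, instead of showing that the sum equals its
  own negative, works in characteristic 2 as well.\<close>

lemma sum_crossing_families:
  assumes fin: "\<And>k l. k < r \<Longrightarrow> l < r \<Longrightarrow> finite (paths G (u k) (v l))"
  shows "(\<Sum>(\<tau>, f) | (\<tau>, f) \<in> families \<and> crossings f \<noteq> {}.
    of_int (sign \<tau>) * (\<Prod>k<r. path_weight w (f k))) = (0 :: 'c::comm_ring_1)"
proof -
  define X where "X s = {(\<tau>, f). (\<tau>, f) \<in> families \<and> crossings f \<noteq> {} \<and> sign \<tau> = s}" for s :: int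
  let ?wt = "\<lambda>(\<tau>, f). (\<Prod>k<r. path_weight w (f k)) :: 'c"
  have "families = (SIGMA \<tau>:{\<tau>. \<tau> permutes {..<r}}. \<Pi>\<^sub>E k\<in>{..<r}. paths G (u k) (v (\<tau> k)))"
    by (auto simp: families_def)
  moreover have "finite \<dots>"
    using fin by (intro finite_SigmaI finite_PiE finite_permutations) (auto dest: permutes_in_image)
  ultimately have "finite families" by simp
  then have finX: "finite (X s)" for s
    by (rule rev_finite_subset) (auto simp: X_def)
  have inv: "switch p \<in> X (- s)" "switch (switch p) = p" "?wt (switch p) = ?wt p" if p: "p \<in> X s" for p s
  proof -
    obtain \<tau> f \<tau>' f' where eq: "p = (\<tau>, f)" "switch (\<tau>, f) = (\<tau>', f')"
      by (metis surj_pair)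
    then have "(\<tau>, f) \<in> families" "crossings f \<noteq> {}" "sign \<tau> = s" using p by (auto simp: X_def)
    note * = switch[OF this(1,2) eq(2)] this(3)
    show "switch p \<in> X (- s)" using * by (simp add: eq X_def)
    show "switch (switch p) = p" using * by (simp add: eq)
    show "?wt (switch p) = ?wt p" using *(5) by (simp add: eq)
  qed
  have "{(\<tau>, f). (\<tau>, f) \<in> families \<and> crossings f \<noteq> {}} = X 1 \<union> X (- 1)"
    by (auto simp: X_def sign_def split: if_splits)
  then have "(\<Sum>(\<tau>, f) | (\<tau>, f) \<in> families \<and> crossings f \<noteq> {}.
      of_int (sign \<tau>) * (\<Prod>k<r. path_weight w (f k))) =
    (\<Sum>(\<tau>, f)\<in>X 1 \<union> X (- 1). of_int (sign \<tau>) * (\<Prod>k<r. path_weight w (f k)))"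
    by simp
  also have "\<dots> = (\<Sum>(\<tau>, f)\<in>X 1. of_int (sign \<tau>) * (\<Prod>k<r. path_weight w (f k))) +
      (\<Sum>(\<tau>, f)\<in>X (- 1). of_int (sign \<tau>) * (\<Prod>k<r. path_weight w (f k)))"
    using finX by (intro sum.union_disjoint) (auto simp: X_def)
  also have "(\<Sum>(\<tau>, f)\<in>X 1. of_int (sign \<tau>) * (\<Prod>k<r. path_weight w (f k))) = sum ?wt (X 1)"
    by (rule sum.cong) (auto simp: X_def)
  also have "(\<Sum>(\<tau>, f)\<in>X (- 1). of_int (sign \<tau>) * (\<Prod>k<r. path_weight w (f k))) = (\<Sum>p\<in>X (- 1). - ?wt p)"
    by (rule sum.cong) (auto simp: X_def)
  also have "\<dots> = - sum ?wt (X (- 1))" by (rule sum_negf)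
  also have "sum ?wt (X (- 1)) = sum ?wt (X 1)"
    by (rule sum.reindex_bij_witness[of _ switch switch]) (use inv(1)[of _ 1] inv(1)[of _ "- 1"] inv(2,3) in auto)
  finally show ?thesis by simp
qed

lemma nonintersecting_iff_crossings:
  assumes "(\<tau>, f) \<in> families"
  shows "crossings f = {} \<longleftrightarrow> (\<forall>i<r. \<forall>j<r. i \<noteq> j \<longrightarrow>
    path_verts G (u i) (f i) \<inter> path_verts G (u j) (f j) = {})"
proof -
  have "crossings f = {} \<longleftrightarrow> (\<forall>x. \<not> 2 \<le> card (hits x f))"
    using crossings_eq[OF assms] by auto
  also have "\<dots> \<longleftrightarrow> (\<forall>x. \<forall>i\<in>hits x f. \<forall>j\<in>hits x f. i = j)"
    using card_le_Suc0_iff_eq[OF finite_hits] by (simp add: not_le numeral_2_eq_2 less_Suc_eq_le)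
  also have "\<dots> \<longleftrightarrow> (\<forall>i<r. \<forall>j<r. i \<noteq> j \<longrightarrow>
      path_verts G (u i) (f i) \<inter> path_verts G (u j) (f j) = {})"
    unfolding hits_def path_verts_def by blast
  finally show ?thesis .
qed

text \<open>Multiplying out the Leibniz formula gives a signed sum over all path families, from
  which the crossing ones cancel.\<close>

lemma det_path_gf:
  fixes w :: "'b \<Rightarrow> 'c::comm_ring_1"
  assumes fin: "\<And>k l. k < r \<Longrightarrow> l < r \<Longrightarrow> finite (paths G (u k) (v l))"
  shows "det (mat r r (\<lambda>(i, j). path_gf G w (u i) (v j))) =
    (\<Sum>\<tau> | \<tau> permutes {..<r}. of_int (sign \<tau>) *
      (\<Sum>f | (\<tau>, f) \<in> families \<and> crossings f = {}. \<Prod>k<r. path_weight w (f k)))"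
proof -
  let ?t = "\<lambda>(\<tau>, f). of_int (sign \<tau>) * (\<Prod>k<r. path_weight w (f k)) :: 'c"
  let ?P = "{\<tau>. \<tau> permutes {..<r}}"
  let ?F = "\<lambda>\<tau>. \<Pi>\<^sub>E k\<in>{..<r}. paths G (u k) (v (\<tau> k))"
  have fam: "families = Sigma ?P ?F" by (auto simp: families_def)
  have finP: "finite ?P" by (simp add: finite_permutations)
  have finF: "finite (?F \<tau>)" if "\<tau> \<in> ?P" for \<tau>
    using fin that by (intro finite_PiE) (auto dest: permutes_in_image)
  have "det (mat r r (\<lambda>(i, j). path_gf G w (u i) (v j))) =
      (\<Sum>\<tau>\<in>?P. of_int (sign \<tau>) * (\<Prod>k<r. \<Sum>p\<in>paths G (u k) (v (\<tau> k)). path_weight w p))"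
    unfolding det_def
    by (auto simp: lessThan_atLeast0 path_gf_def dest: permutes_in_image intro!: sum.cong prod.cong)
  also have "\<dots> = (\<Sum>\<tau>\<in>?P. \<Sum>f\<in>?F \<tau>. ?t (\<tau>, f))"
  proof (rule sum.cong)
    fix \<tau> assume "\<tau> \<in> ?P"
    then have "(\<Prod>k<r. \<Sum>p\<in>paths G (u k) (v (\<tau> k)). path_weight w p) =
        (\<Sum>f\<in>?F \<tau>. \<Prod>k<r. path_weight w (f k))"
      using fin by (intro prod_sum_PiE) (auto dest: permutes_in_image)
    then show "of_int (sign \<tau>) * (\<Prod>k<r. \<Sum>p\<in>paths G (u k) (v (\<tau> k)). path_weight w p) =
        (\<Sum>f\<in>?F \<tau>. ?t (\<tau>, f))"
      by (simp add: sum_distrib_left)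
  qed simp
  also have "\<dots> = sum ?t families"
    unfolding fam using finP finF by (subst sum.Sigma) auto
  also have "\<dots> = sum ?t {p \<in> families. crossings (snd p) \<noteq> {}} + sum ?t {p \<in> families. crossings (snd p) = {}}"
  proof -
    have "finite families" unfolding fam using finP finF by (intro finite_SigmaI)
    then show ?thesis
      by (subst sum.union_disjoint[symmetric]) (auto intro!: sum.cong)
  qed
  also have "{p \<in> families. crossings (snd p) \<noteq> {}} = {(\<tau>, f). (\<tau>, f) \<in> families \<and> crossings f \<noteq> {}}"
    by auto
  also have "sum ?t \<dots> = 0" by (rule sum_crossing_families[OF fin])
  also have "{p \<in> families. crossings (snd p) = {}} =
      Sigma ?P (\<lambda>\<tau>. {f. (\<tau>, f) \<in> families \<and> crossings f = {}})"
    by (auto simp: families_def)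
  also have "sum ?t \<dots> = (\<Sum>\<tau>\<in>?P. \<Sum>f | (\<tau>, f) \<in> families \<and> crossings f = {}. ?t (\<tau>, f))"
  proof (subst sum.Sigma)
    show "\<forall>\<tau>\<in>?P. finite {f. (\<tau>, f) \<in> families \<and> crossings f = {}}"
      using finF by (auto intro: rev_finite_subset simp: families_def)
  qed (use finP in auto)
  finally show ?thesis by (simp add: sum_distrib_left)
qed

end

text \<open>Path \<open>i\<close> of the tuple runs from \<open>us ! \<pi> i\<close> to
  \<open>vs ! i\<close>. Indexed by its starting point instead, path \<open>k\<close> ends at the
  position given by the inverse of \<open>\<pi>\<close>, whence the inverse permutation in the
  family.\<close>

lemma F0_eq_sum_families:
  fixes w :: "'b \<Rightarrow> 'c::comm_ring_1"
  assumes len: "length us = r" "length vs = r" and \<pi>: "\<pi> permutes {..<r}"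
  shows "F0 G w (permute_tuple \<pi> us) vs =
    (\<Sum>f | (inv_into UNIV \<pi>, f) \<in> families r ((!) us) ((!) vs) \<and> crossings r ((!) us) f = {}.
      \<Prod>k<r. path_weight w (f k))"
proof -
  let ?S = "{f. (inv_into UNIV \<pi>, f) \<in> families r ((!) us) ((!) vs) \<and> crossings r ((!) us) f = {}}"
  let ?L = "nonintersecting_rpaths G (permute_tuple \<pi> us) vs"
  let ?i = "\<lambda>f. map (\<lambda>i. f (\<pi> i)) [0..<r]"
  let ?j = "\<lambda>ps. \<lambda>k\<in>{..<r}. ps ! inv_into UNIV \<pi> k"
  have lt: "\<pi> i < r" "inv_into UNIV \<pi> i < r" if "i < r" for i
    using that permutes_in_image[OF \<pi>, of i] permutes_in_image[OF permutes_inv[OF \<pi>], of i] by auto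
  have inv: "\<pi> (inv_into UNIV \<pi> i) = i" "inv_into UNIV \<pi> (\<pi> i) = i" for i
    using permutes_inverses[OF \<pi>] by auto
  have tup: "length (permute_tuple \<pi> us) = r" "\<And>i. i < r \<Longrightarrow> permute_tuple \<pi> us ! i = us ! \<pi> i"
    using len by (auto simp: permute_tuple_def)
  have S: "f \<in> ?S \<longleftrightarrow> f \<in> (\<Pi>\<^sub>E k\<in>{..<r}. paths G (us ! k) (vs ! inv_into UNIV \<pi> k)) \<and>
      (\<forall>i<r. \<forall>j<r. i \<noteq> j \<longrightarrow> path_verts G (us ! i) (f i) \<inter> path_verts G (us ! j) (f j) = {})" for f
    using nonintersecting_iff_crossings[of "inv_into UNIV \<pi>" f r "(!) us" "(!) vs"] permutes_inv[OF \<pi>]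
    by (auto simp: families_def)
  have L: "ps \<in> ?L \<longleftrightarrow> length ps = r \<and> (\<forall>i<r. ps ! i \<in> paths G (us ! \<pi> i) (vs ! i)) \<and>
      (\<forall>i<r. \<forall>j<r. i \<noteq> j \<longrightarrow> path_verts G (us ! \<pi> i) (ps ! i) \<inter> path_verts G (us ! \<pi> j) (ps ! j) = {})" for ps
    unfolding nonintersecting_rpaths_def by (simp add: tup cong: conj_cong)
  have "F0 G w (permute_tuple \<pi> us) vs = (\<Sum>ps\<in>?L. \<Prod>i<r. path_weight w (ps ! i))"
    by (simp add: F0_def tup)
  also have "\<dots> = (\<Sum>f\<in>?S. \<Prod>k<r. path_weight w (f k))"
  proof (rule sum.reindex_bij_witness[of _ ?i ?j])
    fix ps assume ps: "ps \<in> ?L"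
    then have len_ps: "length ps = r" using L by blast
    show "?i (?j ps) = ps"
      using len_ps lt by (intro nth_equalityI) (auto simp: inv)
    have "path_verts G (us ! i) (?j ps i) \<inter> path_verts G (us ! j) (?j ps j) = {}"
      if "i < r" "j < r" "i \<noteq> j" for i j
    proof -
      have "inv_into UNIV \<pi> i \<noteq> inv_into UNIV \<pi> j" using that(3) inv(1) by metis
      then have "path_verts G (us ! \<pi> (inv_into UNIV \<pi> i)) (ps ! inv_into UNIV \<pi> i) \<inter>
          path_verts G (us ! \<pi> (inv_into UNIV \<pi> j)) (ps ! inv_into UNIV \<pi> j) = {}"
        using ps lt that unfolding L by blast
      then show ?thesis using that by (simp add: inv)
    qed
    moreover have "?j ps i \<in> paths G (us ! i) (vs ! inv_into UNIV \<pi> i)" if "i < r" for i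
    proof -
      have "ps ! inv_into UNIV \<pi> i \<in> paths G (us ! \<pi> (inv_into UNIV \<pi> i)) (vs ! inv_into UNIV \<pi> i)"
        using ps lt that unfolding L by blast
      then show ?thesis using that by (simp add: inv)
    qed
    ultimately show "?j ps \<in> ?S" unfolding S by (simp add: PiE_def)
    have "(\<Prod>k<r. path_weight w (?j ps k)) = (\<Prod>k<r. path_weight w (ps ! inv_into UNIV \<pi> k))"
      by (rule prod.cong) auto
    also have "\<dots> = (\<Prod>i<r. path_weight w (ps ! i))"
      using prod.permute[OF permutes_inv[OF \<pi>], of "\<lambda>i. path_weight w (ps ! i)"] by (simp add: o_def)
    finally show "(\<Prod>k<r. path_weight w (?j ps k)) = (\<Prod>i<r. path_weight w (ps ! i))" .
  next
    fix f assume f: "f \<in> ?S"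
    then have ext: "f \<in> extensional {..<r}" unfolding S by (simp add: PiE_def)
    show "?j (?i f) = f"
      using ext lt by (intro extensionalityI[of _ "{..<r}"]) (auto simp: inv)
    have "path_verts G (us ! \<pi> i) (f (\<pi> i)) \<inter> path_verts G (us ! \<pi> j) (f (\<pi> j)) = {}"
      if "i < r" "j < r" "i \<noteq> j" for i j
    proof -
      have "\<pi> i \<noteq> \<pi> j" using that(3) inv(2) by metis
      then show ?thesis using f lt that unfolding S by blast
    qed
    moreover have "f (\<pi> i) \<in> paths G (us ! \<pi> i) (vs ! i)" if "i < r" for i
    proof -
      have "f (\<pi> i) \<in> paths G (us ! \<pi> i) (vs ! inv_into UNIV \<pi> (\<pi> i))"
        using f lt that unfolding S by blast
      then show ?thesis by (simp add: inv)
    qed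
    ultimately show "?i f \<in> ?L" unfolding L by simp
  qed
  finally show ?thesis .
qed

text \<open>Passing to inverse permutations preserves signs and permutes the summands, so the
  inverse in \<open>F0_eq_sum_families\<close> is harmless.\<close>

theorem Lindstroem_Gessel_Viennot:
  fixes w :: "'b \<Rightarrow> 'c::comm_ring_1"
  assumes len: "length us = r" "length vs = r"
    and fin: "\<And>a b. a \<in> set us \<Longrightarrow> b \<in> set vs \<Longrightarrow> finite (paths G a b)"
  shows "(\<Sum>\<pi> | \<pi> permutes {..<r}. of_int (sign \<pi>) * F0 G w (permute_tuple \<pi> us) vs) =
    det (mat r r (\<lambda>(i, j). path_gf G w (us ! i) (vs ! j)))"
proof -
  let ?S = "\<lambda>\<tau>. \<Sum>f | (\<tau>, f) \<in> families r ((!) us) ((!) vs) \<and> crossings r ((!) us) f = {}.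
    \<Prod>k<r. path_weight w (f k)"
  have "(\<Sum>\<pi> | \<pi> permutes {..<r}. of_int (sign \<pi>) * F0 G w (permute_tuple \<pi> us) vs) =
      (\<Sum>\<pi> | \<pi> permutes {..<r}. of_int (sign (inv_into UNIV \<pi>)) * ?S (inv_into UNIV \<pi>))"
  proof (rule sum.cong)
    fix \<pi> assume "\<pi> \<in> {\<pi>. \<pi> permutes {..<r}}"
    then have \<pi>: "\<pi> permutes {..<r}" by simp
    then have "permutation \<pi>" using permutation_permutes by blast
    then show "of_int (sign \<pi>) * F0 G w (permute_tuple \<pi> us) vs = of_int (sign (inv_into UNIV \<pi>)) * ?S (inv_into UNIV \<pi>)"
      using F0_eq_sum_families[OF len \<pi>, of w] by (simp add: sign_inverse)
  qed simp
  also have "\<dots> = (\<Sum>\<tau> | \<tau> permutes {..<r}. of_int (sign \<tau>) * ?S \<tau>)"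
    by (rule sum_permutations_inverse[symmetric])
  also have "\<dots> = det (mat r r (\<lambda>(i, j). path_gf G w (us ! i) (vs ! j)))"
    using len fin by (intro det_path_gf[symmetric]) auto
  finally show ?thesis .
qed

end

section \<open>Compatible tuples\<close>

text \<open>Without inversions the list of values is sorted, and a sorted list of distinct entries
  is determined by its set.\<close>

lemma permutes_no_inversion:
  fixes r :: nat
  assumes \<pi>: "\<pi> permutes {..<r}" and mono: "\<And>i j. i < j \<Longrightarrow> j < r \<Longrightarrow> \<not> \<pi> j < \<pi> i"
  shows "\<pi> = id"
proof -
  have "sorted (map \<pi> [0..<r])"
    using mono by (auto simp: sorted_iff_nth_mono_less not_less)
  moreover have "distinct (map \<pi> [0..<r])"
    using permutes_inj_on[OF \<pi>] by (simp add: distinct_map)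
  moreover have "set (map \<pi> [0..<r]) = set [0..<r]"
    using permutes_image[OF \<pi>] by (simp add: lessThan_atLeast0)
  ultimately have eq: "map \<pi> [0..<r] = [0..<r]"
    by (intro sorted_distinct_set_unique) auto
  have "\<pi> i = i" if "i < r" for i
    using arg_cong[OF eq, of "\<lambda>xs. xs ! i"] that by simp
  moreover have "\<pi> i = i" if "\<not> i < r" for i
    using permutes_not_in[OF \<pi>, of i] that by simp
  ultimately show ?thesis by (intro ext) (metis id_apply)
qed

text \<open>In this form compatibility passes to subtuples because \<open>sorted_wrt\<close> is
  stable under \<open>filter\<close>.\<close>

lemma D_compatible_sorted_wrt:
  "D_compatible D us vs \<longleftrightarrow>
    sorted_wrt (\<lambda>a b. sorted_wrt (\<lambda>c d. \<forall>p\<in>paths D a d. \<forall>q\<in>paths D b c.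
      path_verts D a p \<inter> path_verts D b q \<noteq> {}) vs) us"
  unfolding D_compatible_def sorted_wrt_iff_nth_less by blast

lemma D_compatible_filter:
  assumes "D_compatible D us vs"
  shows "D_compatible D (filter P us) (filter Q vs)"
  unfolding D_compatible_sorted_wrt
  by (rule sorted_wrt_mono_rel[OF sorted_wrt_filter sorted_wrt_filter[OF assms[unfolded D_compatible_sorted_wrt]]])

text \<open>At an inversion \<open>i < j\<close>, \<open>\<pi> j < \<pi> i\<close>, the earlier
  starting vertex is joined to the later end vertex and vice versa. Compatibility forces these two
  paths to meet.\<close>

lemma F0_permute_compatible:
  assumes comp: "D_compatible D us vs" and len: "length us = r" "length vs = r"
    and \<pi>: "\<pi> permutes {..<r}" "\<pi> \<noteq> id"
  shows "F0 D w (permute_tuple \<pi> us) vs = 0"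
proof -
  obtain i j where ij: "i < j" "j < r" "\<pi> j < \<pi> i"
    using permutes_no_inversion[OF \<pi>(1)] \<pi>(2) by blast
  have lt: "\<pi> i < r" using permutes_in_image[OF \<pi>(1), of i] ij by simp
  have tup: "length (permute_tuple \<pi> us) = r" "\<And>k. k < r \<Longrightarrow> permute_tuple \<pi> us ! k = us ! \<pi> k"
    using len by (auto simp: permute_tuple_def)
  have "False" if "ps \<in> nonintersecting_rpaths D (permute_tuple \<pi> us) vs" for ps
  proof -
    have ps: "ps ! i \<in> paths D (us ! \<pi> i) (vs ! i)" "ps ! j \<in> paths D (us ! \<pi> j) (vs ! j)"
      "path_verts D (us ! \<pi> j) (ps ! j) \<inter> path_verts D (us ! \<pi> i) (ps ! i) = {}"
      using that ij unfolding nonintersecting_rpaths_def by (auto simp: tup)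
    then show False
      using comp[unfolded D_compatible_def, rule_format, of "\<pi> j" "\<pi> i" i j, OF _ ps(2,1)] ij lt len
      by simp
  qed
  then have "nonintersecting_rpaths D (permute_tuple \<pi> us) vs = {}" by blast
  then show ?thesis by (simp add: F0_def)
qed

lemma permute_tuple_id: "permute_tuple id us = us"
  by (simp add: permute_tuple_def map_nth)

lemma sum_permutations_compatible:
  assumes comp: "D_compatible D us vs" and len: "length us = r" "length vs = r"
  shows "(\<Sum>\<pi> | \<pi> permutes {..<r}. of_int (sign \<pi>) * F0 D w (permute_tuple \<pi> us) vs) = F0 D w us vs"
proof -
  have "F0 D w (permute_tuple \<pi> us) vs = 0" if "\<pi> permutes {..<r}" "\<pi> \<noteq> id" for \<pi>
    using comp len that by (rule F0_permute_compatible)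
  then have "(\<Sum>\<pi> | \<pi> permutes {..<r}. of_int (sign \<pi>) * F0 D w (permute_tuple \<pi> us) vs) =
      (\<Sum>\<pi>\<in>{id}. of_int (sign \<pi>) * F0 D w (permute_tuple \<pi> us) vs)"
    by (intro sum.mono_neutral_right) (auto simp: finite_permutations permutes_id)
  then show ?thesis by (simp add: permute_tuple_id sign_id)
qed

section \<open>The Pfaffian of the block matrix\<close>

lemma const_simps [simp]:
  "const 0 = 0" "const 1 = 1" "const (- a) = - const a"
  by (simp_all add: const_def single_uminus)

lemma const_add: "const (a + b) = const a + const b"
  by (simp add: const_def single_add)

lemma const_mult: "const (a * b) = const a * const b"
  by (simp add: const_def mult_single)

lemma const_power: "const (a ^ n) = const a ^ n"
  by (induction n) (simp_all add: const_mult)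

lemma const_sum: "const (sum f X) = (\<Sum>x\<in>X. const (f x))"
  by (induction X rule: infinite_finite_induct) (simp_all add: const_add)

lemma pfl_const: "pfl (\<lambda>x y. const (w x y)) xs = const (pfl w xs)"
  by (induction w xs rule: pfl.induct) (auto simp: const_sum const_mult const_power intro!: sum.cong)

lemma alternating_const:
  assumes "alternating_form w"
  shows "alternating_form (\<lambda>x y. const (w x y))"
proof -
  have "const (w x y) = - const (w y x)" for x y
    using arg_cong[OF alt_swap[OF assms, of x y], of const] by simp
  moreover have "const (w x x) = 0" for x
    by (simp add: alt_self[OF assms])
  ultimately show ?thesis unfolding alternating_form_def by blast
qed

section \<open>Entries of the block matrix\<close>

lemma mult_J_mat:
  assumes "X \<in> carrier_mat m n" "i < m" "j < n"
  shows "(X * J_mat n) $$ (i, j) = X $$ (i, n - 1 - j)"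
proof -
  have "(X * J_mat n) $$ (i, j) = (\<Sum>k\<in>{0..<n}. X $$ (i, k) * (if k + j + 1 = n then 1 else 0))"
    using assms by (simp add: J_mat_def scalar_prod_def)
  also have "\<dots> = (\<Sum>k\<in>{0..<n}. if k = n - 1 - j then X $$ (i, k) else 0)"
    by (rule sum.cong) (use assms in auto)
  finally show ?thesis using assms by simp
qed

lemma J_mat_mult:
  assumes "X \<in> carrier_mat n m" "i < n" "j < m"
  shows "(J_mat n * X) $$ (i, j) = X $$ (n - 1 - i, j)"
proof -
  have "(J_mat n * X) $$ (i, j) = (\<Sum>k\<in>{0..<n}. (if i + k + 1 = n then 1 else 0) * X $$ (k, j))"
    using assms by (simp add: J_mat_def scalar_prod_def)
  also have "\<dots> = (\<Sum>k\<in>{0..<n}. if k = n - 1 - i then X $$ (k, j) else 0)"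
    by (rule sum.cong) (use assms in auto)
  finally show ?thesis using assms by simp
qed

lemma J_mat_carrier [simp]: "J_mat n \<in> carrier_mat n n"
  by (simp add: J_mat_def)

text \<open>The factors \<open>J_mat\<close> reverse the indices of the second block, so the block
  matrix is the unreversed form evaluated on a list whose second part is reversed.\<close>

lemma Pf_block_mat:
  fixes A B :: "'k::field mat" and D :: "('v, 'e) pre_digraph"
  assumes A: "A \<in> carrier_mat (length us) (length us)" and B: "B \<in> carrier_mat (length vs) (length vs)"
    and even: "even (length us + length vs)"
  shows "Pf (block_mat D us vs A B) =
    pfl (block_form
        (\<lambda>i j. const (mat_form (copfaffian_mat A) i j / Pf A))
        (\<lambda>i j. - const (mat_form (copfaffian_mat B) i j / Pf B))
        (\<lambda>i j. z_var * path_gf D x_var (us ! i) (vs ! j)))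
      (map Inl [0..<length us] @ map Inr (rev [0..<length vs]))"
    (is "_ = pfl ?w ?zs")
proof -
  define M where "M = length us"
  define N where "N = length vs"
  define X :: "('e, 'k) wpoly mat" where "X = block_mat D us vs A B"
  \<comment> \<open>The label of row \<open>i\<close>: after the first \<open>M\<close> rows the
    vertices of \<open>vs\<close> are counted downwards from \<open>N - 1\<close>.\<close>
  define \<phi> :: "nat \<Rightarrow> nat + nat" where "\<phi> i = (if i < M then Inl i else Inr (N - 1 - (i - M)))" for i
  let ?H = "H_mat D x_var us vs :: ('e, 'k) wpoly mat"
  let ?b = "transpose_mat (copfaffian_mat B)"
  have H: "?H \<in> carrier_mat M N" by (simp add: H_mat_def M_def N_def)
  have b: "?b \<in> carrier_mat N N" using B by (intro carrier_matI) (auto simp: N_def)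
  have a: "copfaffian_mat A \<in> carrier_mat M M" using A by (intro carrier_matI) (auto simp: M_def)
  have dims: "dim_row X = M + N" "dim_col X = M + N"
    using A B by (simp_all add: X_def block_mat_def Let_def M_def N_def J_mat_def)
  have zs: "?zs = map \<phi> [0..<M + N]"
    by (rule nth_equalityI) (auto simp: nth_append rev_nth \<phi>_def M_def N_def)
  have entry: "X $$ (i, j) = ?w (\<phi> i) (\<phi> j)" if ij: "i < M + N" "j < M + N" for i j
  proof -
    have HJ: "(?H * J_mat N) $$ (p, q) = path_gf D x_var (us ! p) (vs ! (N - 1 - q))" if "p < M" "q < N" for p q
      using mult_J_mat[OF H that] that by (simp add: H_mat_def M_def N_def)
    have JH: "(J_mat N * transpose_mat ?H) $$ (p, q) = path_gf D x_var (us ! q) (vs ! (N - 1 - p))"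
      if "p < N" "q < M" for p q
      using J_mat_mult[of "transpose_mat ?H" N M p q] H that by (simp add: H_mat_def M_def N_def)
    have JbJ: "(J_mat N * ?b * J_mat N) $$ (p, q) = copfaffian_mat B $$ (N - 1 - q, N - 1 - p)"
      if "p < N" "q < N" for p q
    proof -
      have "(J_mat N * ?b * J_mat N) $$ (p, q) = (J_mat N * ?b) $$ (p, N - 1 - q)"
        by (rule mult_J_mat[OF mult_carrier_mat[OF J_mat_carrier b] that])
      also have "\<dots> = ?b $$ (N - 1 - p, N - 1 - q)"
        by (rule J_mat_mult[OF b]) (use that in auto)
      finally show ?thesis using that B by (simp add: N_def)
    qed
    define K :: "('e, 'k) wpoly mat" where "K = map_mat const ((1 / Pf A) \<cdot>\<^sub>m copfaffian_mat A)"
    define L where "L = z_var \<cdot>\<^sub>m (?H * J_mat N)"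
    define K' :: "('e, 'k) wpoly mat" where "K' = map_mat const ((1 / Pf B) \<cdot>\<^sub>m (J_mat N * ?b * J_mat N))"
    define L' where "L' = - (z_var \<cdot>\<^sub>m (J_mat N * transpose_mat ?H))"
    have X: "X = four_block_mat K L L' K'"
      by (simp only: X_def block_mat_def Let_def N_def K_def L_def K'_def L'_def)
    have dim: "dim_row K = M" "dim_col K = M" "dim_row K' = N" "dim_col K' = N"
      using A by (simp_all add: K_def K'_def M_def J_mat_def)
    have Xij: "X $$ (i, j) =
        (if i < M then if j < M then K $$ (i, j) else L $$ (i, j - M)
         else if j < M then L' $$ (i - M, j) else K' $$ (i - M, j - M))"
      unfolding X using ij by (subst index_mat_four_block) (simp_all only: dim)
    have K: "K $$ (p, q) = const (mat_form (copfaffian_mat A) p q / Pf A)" if "p < M" "q < M" for p q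
      using that A by (simp add: K_def M_def mat_form_def)
    have L: "L $$ (p, q) = z_var * path_gf D x_var (us ! p) (vs ! (N - 1 - q))" if "p < M" "q < N" for p q
      unfolding HJ[OF that, symmetric] using that by (simp add: L_def H_mat_def M_def J_mat_def)
    have L': "L' $$ (p, q) = - (z_var * path_gf D x_var (us ! q) (vs ! (N - 1 - p)))" if "p < N" "q < M" for p q
      unfolding JH[OF that, symmetric] using that by (simp add: L'_def H_mat_def M_def J_mat_def)
    \<comment> \<open>The transpose of the skew-symmetric copfaffian matrix is its negative; this
      yields the sign in front of the second block.\<close>
    have K': "K' $$ (p, q) = - const (mat_form (copfaffian_mat B) (N - 1 - p) (N - 1 - q) / Pf B)"
      if "p < N" "q < N" for p q
    proof -
      have lt: "N - 1 - p < N" "N - 1 - q < N" using that by auto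
      have "K' $$ (p, q) = const (copfaffian_mat B $$ (N - 1 - q, N - 1 - p) / Pf B)"
        unfolding JbJ[OF that, symmetric] using that by (simp add: K'_def J_mat_def)
      also have "copfaffian_mat B $$ (N - 1 - q, N - 1 - p) = mat_form (copfaffian_mat B) (N - 1 - q) (N - 1 - p)"
        using lt B by (simp add: mat_form_def N_def)
      also have "\<dots> = - mat_form (copfaffian_mat B) (N - 1 - p) (N - 1 - q)"
        by (rule alt_swap[OF alternating_copfaffian_mat])
      finally show ?thesis by simp
    qed
    show ?thesis
    proof (cases "i < M"; cases "j < M")
      assume "i < M" "j < M"
      then show ?thesis by (simp add: Xij K \<phi>_def)
    next
      assume "i < M" "\<not> j < M"
      then show ?thesis using ij L[of i "j - M"] by (simp add: Xij \<phi>_def)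
    next
      assume "\<not> i < M" "j < M"
      then show ?thesis using ij L'[of "i - M" j] by (simp add: Xij \<phi>_def)
    next
      assume "\<not> i < M" "\<not> j < M"
      then show ?thesis using ij K'[of "i - M" "j - M"] by (simp add: Xij \<phi>_def)
    qed
  qed
  have "Pf X = pfl (\<lambda>i j. X $$ (i, j)) [0..<M + N]"
    using Pf_eq_pfl[of X] even by (simp add: dims M_def N_def)
  also have "\<dots> = pfl (\<lambda>i j. ?w (\<phi> i) (\<phi> j)) [0..<M + N]"
    by (rule pfl_cong) (simp add: entry)
  also have "\<dots> = pfl ?w ?zs" unfolding zs by (rule pfl_map[symmetric])
  finally show ?thesis unfolding X_def .
qed

section \<open>Subsets of vertices as sets of positions\<close>

lemma positions_image:
  assumes "distinct us" "P \<subseteq> {..<length us}"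
  shows "positions us ((!) us ` P) = P"
  using assms by (auto simp: positions_def nth_eq_iff_index_eq)

lemma tuple_of_image:
  assumes "distinct us" "P \<subseteq> {..<length us}"
  shows "tuple_of us ((!) us ` P) = map ((!) us) (filter (\<lambda>i. i \<in> P) [0..<length us])"
proof -
  have "tuple_of us ((!) us ` P) = filter (\<lambda>x. x \<in> (!) us ` P) (map ((!) us) [0..<length us])"
    by (simp add: tuple_of_def map_nth)
  also have "\<dots> = map ((!) us) (filter (\<lambda>i. us ! i \<in> (!) us ` P) [0..<length us])"
    by (simp add: filter_map o_def)
  also have "filter (\<lambda>i. us ! i \<in> (!) us ` P) [0..<length us] = filter (\<lambda>i. i \<in> P) [0..<length us]"
    using positions_image[OF assms] by (intro filter_cong) (auto simp: positions_def)
  finally show ?thesis .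
qed

lemma sum_subsets_of_size:
  assumes "distinct us"
  shows "(\<Sum>I\<in>subsets_of_size r us. f I) =
    (\<Sum>P | P \<subseteq> {..<length us} \<and> card P = r. f ((!) us ` P))"
proof (rule sum.reindex_bij_witness[where i = "\<lambda>P. (!) us ` P" and j = "positions us"])
  fix I assume I: "I \<in> subsets_of_size r us"
  show eq: "(!) us ` positions us I = I"
  proof (intro equalityI subsetI)
    fix x assume x: "x \<in> I"
    then have "x \<in> set us" using I by (auto simp: subsets_of_size_def)
    then obtain i where "i < length us" "x = us ! i" by (auto simp: in_set_conv_nth)
    then show "x \<in> (!) us ` positions us I" using x by (auto simp: positions_def)
  qed (auto simp: positions_def)
  show "positions us I \<in> {P. P \<subseteq> {..<length us} \<and> card P = r}"
  proof -
    have "inj_on ((!) us) (positions us I)"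
      using assms by (auto simp: inj_on_def positions_def nth_eq_iff_index_eq)
    then have "card (positions us I) = card I" using eq card_image by metis
    then show ?thesis using I by (auto simp: subsets_of_size_def positions_def)
  qed
  show "f ((!) us ` positions us I) = f I" by (simp add: eq)
next
  fix P assume P: "P \<in> {P. P \<subseteq> {..<length us} \<and> card P = r}"
  then show "positions us ((!) us ` P) = P" using positions_image[OF assms] by blast
  have "inj_on ((!) us) P"
    using assms P by (auto intro!: inj_on_nth)
  then show "(!) us ` P \<in> subsets_of_size r us"
    using P by (auto simp: subsets_of_size_def card_image)
qed

lemma length_filter_subset:
  assumes "P \<subseteq> {..<n}"
  shows "length (filter (\<lambda>i. i \<in> P) [0..<n]) = card P"
proof -
  have "set (filter (\<lambda>i. i \<in> P) [0..<n]) = P" using assms by auto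
  then show ?thesis by (metis distinct_card distinct_filter distinct_upt)
qed

lemma length_tuple_of:
  assumes "distinct us" "I \<in> subsets_of_size r us"
  shows "length (tuple_of us I) = r"
proof -
  have "set (tuple_of us I) = I" using assms(2) by (auto simp: tuple_of_def subsets_of_size_def)
  moreover have "distinct (tuple_of us I)" using assms(1) by (simp add: tuple_of_def)
  ultimately show ?thesis using assms(2) distinct_card by (fastforce simp: subsets_of_size_def)
qed

lemma const_Pf_principal_submatrix:
  assumes "distinct us" "A \<in> carrier_mat (length us) (length us)" "P \<subseteq> {..<length us}" "even (card P)"
  shows "const (Pf (principal_submatrix A us ((!) us ` P))) =
    pfl (\<lambda>i j. const (mat_form A i j)) (filter (\<lambda>i. i \<in> P) [0..<length us])"
proof -
  have "{i. i < length us \<and> i \<in> P} = P" using assms(3) by auto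
  then show ?thesis
    using Pf_submatrix_mat_form[OF assms(2), of P] assms(4)
    by (simp add: principal_submatrix_def positions_image[OF assms(1,3)] pfl_const)
qed

text \<open>Divided by the nonzero Pfaffian, \<open>copfaffian_mat_mult\<close> becomes the inverse
  relation that the bipartite theorem asks for.\<close>

lemma const_copfaffian_mat_inverse:
  fixes A :: "'k::field mat"
  assumes A: "A \<in> carrier_mat n n" "even n" "skew_symmetric_mat A" "invertible_mat A" and ij: "i < n" "j < n"
  shows "(\<Sum>k<n. const (mat_form (copfaffian_mat A) i k / Pf A) * const (mat_form A j k)) =
    (if i = j then 1 else 0)"
proof -
  have "(\<Sum>k<n. mat_form (copfaffian_mat A) i k / Pf A * mat_form A j k) =
      (\<Sum>k<n. mat_form (copfaffian_mat A) i k * mat_form A j k) / Pf A"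
    by (simp add: sum_divide_distrib)
  also have "\<dots> = (if i = j then 1 else 0)"
    using copfaffian_mat_mult[OF A(1-3) ij(2,1)] Pf_nonzero[OF A] by simp
  finally show ?thesis by (simp add: const_mult[symmetric] const_sum[symmetric])
qed

text \<open>The path count is left abstract as \<open>S\<close>, required only to equal the minors
  of the path matrix. The signed sums and, for compatible tuples, \<open>F0\<close> itself are both
  instances.\<close>

lemma sum_minors_eq_Pf_block_mat:
  fixes A B :: "'k::field mat" and D :: "('v, 'e) pre_digraph"
    and S :: "nat \<Rightarrow> 'v set \<Rightarrow> 'v set \<Rightarrow> ('e, 'k) wpoly"
  assumes us: "distinct us" "even (length us)" and vs: "distinct vs" "even (length vs)"
    and A: "A \<in> carrier_mat (length us) (length us)" "skew_symmetric_mat A" "invertible_mat A"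
    and B: "B \<in> carrier_mat (length vs) (length vs)" "skew_symmetric_mat B" "invertible_mat B"
    and S: "\<And>r I J. I \<in> subsets_of_size r us \<Longrightarrow> J \<in> subsets_of_size r vs \<Longrightarrow>
      S r I J = det (mat r r (\<lambda>(i, j). path_gf D x_var (tuple_of us I ! i) (tuple_of vs J ! j)))"
  shows "(\<Sum>r | r \<le> min (length us) (length vs) \<and> even r. z_var ^ r *
      (\<Sum>I\<in>subsets_of_size r us. \<Sum>J\<in>subsets_of_size r vs.
         const (Pf (principal_submatrix A us I)) * const (Pf (principal_submatrix B vs J)) * S r I J))
    = const (Pf A) * const (Pf B) * Pf (block_mat D us vs A B)"
proof -
  define M where "M = length us"
  define N where "N = length vs"
  define a :: "nat \<Rightarrow> nat \<Rightarrow> ('e, 'k) wpoly" where "a i j = const (mat_form A i j)" for i j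
  define b :: "nat \<Rightarrow> nat \<Rightarrow> ('e, 'k) wpoly" where "b i j = const (mat_form B i j)" for i j
  define a' :: "nat \<Rightarrow> nat \<Rightarrow> ('e, 'k) wpoly"
    where "a' i j = const (mat_form (copfaffian_mat A) i j / Pf A)" for i j
  define b' :: "nat \<Rightarrow> nat \<Rightarrow> ('e, 'k) wpoly"
    where "b' i j = const (mat_form (copfaffian_mat B) i j / Pf B)" for i j
  define g :: "nat \<Rightarrow> nat \<Rightarrow> ('e, 'k) wpoly" where "g i j = path_gf D x_var (us ! i) (vs ! j)" for i j
  define R where "R = {r. r \<le> min M N \<and> even r}"
  let ?fM = "\<lambda>P. filter (\<lambda>i. i \<in> P) [0..<M]" and ?fN = "\<lambda>Q. filter (\<lambda>i. i \<in> Q) [0..<N]"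
  define T where "T P Q = (let xI = ?fM P; yJ = ?fN Q in
      if length xI = length yJ
      then pfl a xI * pfl b yJ * det (mat (length xI) (length xI) (\<lambda>(i, j). z_var * g (xI ! i) (yJ ! j)))
      else 0)" for P Q
  have alt_div: "alternating_form (\<lambda>i j. w i j / c)" if "alternating_form w" for w :: "nat \<Rightarrow> nat \<Rightarrow> 'k" and c
  proof -
    have "w x y / c = - (w y x / c)" for x y
      using arg_cong[OF alt_swap[OF that, of x y], of "\<lambda>t. t / c"] by simp
    moreover have "w x x / c = 0" for x by (simp add: alt_self[OF that])
    ultimately show ?thesis unfolding alternating_form_def by blast
  qed
  have alt: "alternating_form a" "alternating_form b" "alternating_form a'" "alternating_form b'"
    unfolding a_def b_def a'_def b'_def
    by (intro alternating_const alt_div alternating_mat_form alternating_copfaffian_mat A(2) B(2))+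
  have "(\<Sum>P\<in>Pow (set [0..<M]). \<Sum>Q\<in>Pow (set [0..<N]). T P Q) = pfl a [0..<M] * pfl b [0..<N] *
      pfl (block_form a' (\<lambda>i j. - b' i j) (\<lambda>i j. z_var * g i j)) (map Inl [0..<M] @ map Inr (rev [0..<N]))"
    unfolding T_def
  proof (rule pfl_sum_subsets_bipartite[OF alt])
    fix i j assume "i \<in> set [0..<M]" "j \<in> set [0..<M]"
    then show "(\<Sum>k\<in>set [0..<M]. a' i k * a j k) = (if i = j then 1 else 0)"
      using const_copfaffian_mat_inverse[OF A(1) us(2) A(2,3), of i j]
      by (simp add: a_def a'_def M_def lessThan_atLeast0)
  next
    fix i j assume "i \<in> set [0..<N]" "j \<in> set [0..<N]"
    then show "(\<Sum>k\<in>set [0..<N]. b' i k * b j k) = (if i = j then 1 else 0)"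
      using const_copfaffian_mat_inverse[OF B(1) vs(2) B(2,3), of i j]
      by (simp add: b_def b'_def N_def lessThan_atLeast0)
  qed simp_all
  also have "\<dots> = const (Pf A) * const (Pf B) * Pf (block_mat D us vs A B)"
    using Pf_block_mat[OF A(1) B(1), of D] us(2) vs(2) Pf_mat_form[OF A(1) us(2)] Pf_mat_form[OF B(1) vs(2)]
    by (simp add: a_def[abs_def] b_def[abs_def] a'_def[abs_def] b'_def[abs_def] g_def[abs_def] pfl_const M_def N_def)
  finally have rhs: "(\<Sum>P\<in>Pow {..<M}. \<Sum>Q\<in>Pow {..<N}. T P Q) =
      const (Pf A) * const (Pf B) * Pf (block_mat D us vs A B)"
    by (simp add: lessThan_atLeast0)
  have finR: "finite R" unfolding R_def by (rule finite_subset[of _ "{..M}"]) auto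
  have T_eq: "T P Q = z_var ^ r * (const (Pf (principal_submatrix A us ((!) us ` P))) *
      const (Pf (principal_submatrix B vs ((!) vs ` Q))) * S r ((!) us ` P) ((!) vs ` Q))"
    if r: "even r" and P: "P \<subseteq> {..<M}" "card P = r" and Q: "Q \<subseteq> {..<N}" "card Q = r" for P Q r
  proof -
    have len: "length (?fM P) = r" "length (?fN Q) = r"
      using length_filter_subset[OF P(1)] length_filter_subset[OF Q(1)] P(2) Q(2) by simp_all
    have tup: "tuple_of us ((!) us ` P) = map ((!) us) (?fM P)" "tuple_of vs ((!) vs ` Q) = map ((!) vs) (?fN Q)"
      using tuple_of_image[OF us(1)] tuple_of_image[OF vs(1)] P(1) Q(1) by (simp_all add: M_def N_def)
    have inj: "inj_on ((!) us) P" "inj_on ((!) vs) Q"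
      using us(1) vs(1) P(1) Q(1) by (auto simp: M_def N_def intro!: inj_on_nth)
    have sub: "(!) us ` P \<in> subsets_of_size r us" "(!) vs ` Q \<in> subsets_of_size r vs"
      using P Q inj by (auto simp: subsets_of_size_def card_image M_def N_def)
    have "S r ((!) us ` P) ((!) vs ` Q) = det (mat r r (\<lambda>(i, j). g (?fM P ! i) (?fN Q ! j)))"
      unfolding S[OF sub] tup g_def
      by (intro arg_cong[of _ _ det] eq_matI) (auto simp: len)
    \<comment> \<open>Taking \<open>z\<close> out of each of the \<open>r\<close> rows produces the
      factor \<open>z_var ^ r\<close>.\<close>
    moreover have "mat r r (\<lambda>(i, j). z_var * g (?fM P ! i) (?fN Q ! j)) =
        z_var \<cdot>\<^sub>m mat r r (\<lambda>(i, j). g (?fM P ! i) (?fN Q ! j))"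
      by (rule eq_matI) auto
    moreover have "const (Pf (principal_submatrix A us ((!) us ` P))) = pfl a (?fM P)"
      "const (Pf (principal_submatrix B vs ((!) vs ` Q))) = pfl b (?fN Q)"
      using const_Pf_principal_submatrix[OF us(1) A(1), of P] const_Pf_principal_submatrix[OF vs(1) B(1), of Q]
        P Q r by (simp_all add: a_def[abs_def] b_def[abs_def] M_def N_def)
    ultimately show ?thesis by (simp add: T_def Let_def len)
  qed
  \<comment> \<open>A pair of equal even size is counted for exactly one \<open>r\<close>. Any other
    pair contributes 0: unequal sizes by the definition of \<open>T\<close>, odd sizes because odd
    Pfaffians vanish.\<close>
  have T_sum: "(\<Sum>r\<in>R. if card P = r \<and> card Q = r then T P Q else 0) = T P Q"
    if P: "P \<subseteq> {..<M}" and Q: "Q \<subseteq> {..<N}" for P Q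
  proof (cases "card P \<in> R \<and> card P = card Q")
    case True
    then have "(\<Sum>r\<in>R. if card P = r \<and> card Q = r then T P Q else 0) =
        (\<Sum>r\<in>R. if card P = r then T P Q else 0)"
      by (intro sum.cong) auto
    then show ?thesis using True finR by auto
  next
    case False
    have "card P \<le> M" "card Q \<le> N" using card_mono[OF _ P] card_mono[OF _ Q] by auto
    then have "card P \<noteq> card Q \<or> odd (card P)" using False by (auto simp: R_def)
    then have "T P Q = 0"
      using pfl_odd[of "?fM P" a] by (auto simp: T_def Let_def length_filter_subset[OF P] length_filter_subset[OF Q])
    then show ?thesis by (auto intro!: sum.neutral)
  qed
  have "(\<Sum>r | r \<le> min (length us) (length vs) \<and> even r. z_var ^ r *
      (\<Sum>I\<in>subsets_of_size r us. \<Sum>J\<in>subsets_of_size r vs.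
         const (Pf (principal_submatrix A us I)) * const (Pf (principal_submatrix B vs J)) * S r I J)) =
    (\<Sum>r\<in>R. \<Sum>P | P \<subseteq> {..<M} \<and> card P = r. \<Sum>Q | Q \<subseteq> {..<N} \<and> card Q = r. T P Q)"
    unfolding sum_subsets_of_size[OF us(1)] sum_subsets_of_size[OF vs(1)] sum_distrib_left
      M_def[symmetric] N_def[symmetric] R_def[symmetric]
    by (intro sum.cong refl, rule T_eq[symmetric]) (auto simp: R_def)
  also have "\<dots> = (\<Sum>r\<in>R. \<Sum>P\<in>Pow {..<M}. \<Sum>Q\<in>Pow {..<N}. if card P = r \<and> card Q = r then T P Q else 0)"
  proof (rule sum.cong)
    fix r
    have "(\<Sum>Q\<in>Pow {..<N}. if card P = r \<and> card Q = r then T P Q else 0) =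
        (if card P = r then \<Sum>Q | Q \<subseteq> {..<N} \<and> card Q = r. T P Q else 0)" for P
      by (auto simp: sum.If_cases Pow_def Int_def intro!: sum.cong)
    then show "(\<Sum>P | P \<subseteq> {..<M} \<and> card P = r. \<Sum>Q | Q \<subseteq> {..<N} \<and> card Q = r. T P Q) =
        (\<Sum>P\<in>Pow {..<M}. \<Sum>Q\<in>Pow {..<N}. if card P = r \<and> card Q = r then T P Q else 0)"
      by (simp add: sum.If_cases Pow_def Int_def)
  qed simp
  also have "\<dots> = (\<Sum>P\<in>Pow {..<M}. \<Sum>Q\<in>Pow {..<N}. \<Sum>r\<in>R. if card P = r \<and> card Q = r then T P Q else 0)"
    by (subst sum.swap, rule sum.cong, simp, subst sum.swap, simp)
  also have "\<dots> = (\<Sum>P\<in>Pow {..<M}. \<Sum>Q\<in>Pow {..<N}. T P Q)"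
    by (intro sum.cong refl) (simp add: T_sum)
  finally show ?thesis unfolding rhs .
qed

theorem theorem4p5:
  fixes D :: "('v, 'e) pre_digraph"
    and M N :: nat
    and us vs :: "'v list"
    and A B :: "'k::field mat"
  assumes "nomulti_digraph D" and "acyclic_digraph D"
    and "\<And>u v. u \<in> verts D \<Longrightarrow> v \<in> verts D \<Longrightarrow> finite (paths D u v)"
    and "even M" and "even N"
    and "distinct us" and "set us \<subseteq> verts D" and "length us = M"
    and "distinct vs" and "set vs \<subseteq> verts D" and "length vs = N"
    and "A \<in> carrier_mat M M" and "skew_symmetric_mat A" and "invertible_mat A"
    and "B \<in> carrier_mat N N" and "skew_symmetric_mat B" and "invertible_mat B"
  shows
    "((\<Sum>r | r \<le> min M N \<and> even r. z_var ^ r *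
        (\<Sum>I\<in>subsets_of_size r us. \<Sum>J\<in>subsets_of_size r vs.
           const (Pf (principal_submatrix A us I)) * const (Pf (principal_submatrix B vs J)) *
           (\<Sum>\<pi> | \<pi> permutes {..<r}. of_int (sign \<pi>) *
              F0 D x_var (permute_tuple \<pi> (tuple_of us I)) (tuple_of vs J))))
      = const (Pf A) * const (Pf B) * Pf (block_mat D us vs A B)) \<and>
     (D_compatible D us vs \<longrightarrow>
      (\<Sum>r | r \<le> min M N \<and> even r. z_var ^ r *
        (\<Sum>I\<in>subsets_of_size r us. \<Sum>J\<in>subsets_of_size r vs.
           const (Pf (principal_submatrix A us I)) * const (Pf (principal_submatrix B vs J)) *
           F0 D x_var (tuple_of us I) (tuple_of vs J)))
      = const (Pf A) * const (Pf B) * Pf (block_mat D us vs A B))"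
proof -
  interpret wf_digraph D using assms(1) by (simp add: nomulti_digraph_def)
  interpret acyclic_wf_digraph D by unfold_locales (rule assms(2))
  have lgv: "(\<Sum>\<pi> | \<pi> permutes {..<r}. of_int (sign \<pi>) *
        F0 D x_var (permute_tuple \<pi> (tuple_of us I)) (tuple_of vs J)) =
      (det (mat r r (\<lambda>(i, j). path_gf D x_var (tuple_of us I ! i) (tuple_of vs J ! j))) :: ('e, 'k) wpoly)"
    if I: "I \<in> subsets_of_size r us" and J: "J \<in> subsets_of_size r vs" for r I J
  proof (rule Lindstroem_Gessel_Viennot)
    show "length (tuple_of us I) = r" "length (tuple_of vs J) = r"
      using length_tuple_of[OF assms(6) I] length_tuple_of[OF assms(9) J] .
    fix x y assume "x \<in> set (tuple_of us I)" "y \<in> set (tuple_of vs J)"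
    then show "finite (paths D x y)"
      using assms(7,10) by (intro assms(3)) (auto simp: tuple_of_def)
  qed
  note main = sum_minors_eq_Pf_block_mat[of us vs A B, unfolded assms(8,11),
      OF assms(6,4,9,5) assms(12-17)]
  have compatible: "F0 D x_var (tuple_of us I) (tuple_of vs J) =
      (det (mat r r (\<lambda>(i, j). path_gf D x_var (tuple_of us I ! i) (tuple_of vs J ! j))) :: ('e, 'k) wpoly)"
    if "D_compatible D us vs" and I: "I \<in> subsets_of_size r us" and J: "J \<in> subsets_of_size r vs" for r I J
  proof -
    \<comment> \<open>Subtuples inherit compatibility, so the signed sum for \<open>I\<close> and
      \<open>J\<close> reduces to its identity term.\<close>
    have "D_compatible D (tuple_of us I) (tuple_of vs J)"
      unfolding tuple_of_def using that(1) by (rule D_compatible_filter)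
    then show ?thesis
      using sum_permutations_compatible[OF _ length_tuple_of[OF assms(6) I] length_tuple_of[OF assms(9) J],
          of D "x_var :: 'e \<Rightarrow> ('e, 'k) wpoly"] lgv[OF I J] by simp
  qed
  have "(\<Sum>r | r \<le> min M N \<and> even r. z_var ^ r *
        (\<Sum>I\<in>subsets_of_size r us. \<Sum>J\<in>subsets_of_size r vs.
           const (Pf (principal_submatrix A us I)) * const (Pf (principal_submatrix B vs J)) *
           (\<Sum>\<pi> | \<pi> permutes {..<r}. of_int (sign \<pi>) *
              F0 D x_var (permute_tuple \<pi> (tuple_of us I)) (tuple_of vs J))))
      = const (Pf A) * const (Pf B) * Pf (block_mat D us vs A B)"
    by (rule main) (rule lgv)
  moreover have "(\<Sum>r | r \<le> min M N \<and> even r. z_var ^ r *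
        (\<Sum>I\<in>subsets_of_size r us. \<Sum>J\<in>subsets_of_size r vs.
           const (Pf (principal_submatrix A us I)) * const (Pf (principal_submatrix B vs J)) *
           F0 D x_var (tuple_of us I) (tuple_of vs J)))
      = const (Pf A) * const (Pf B) * Pf (block_mat D us vs A B)"
    if "D_compatible D us vs"
    by (rule main) (rule compatible[OF that])
  ultimately show ?thesis by blast
qed

end
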